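(* In the two-period screening model with multiplicative values and a spot market with price $p^S>c$ described in the context, let $(q^D,t^D)$ be the optimal mechanism for the seller subject to (IC0), (IC1) and the spot-market participation constraint. Then $q^D(\theta,\cdot)=q^*(\theta,\cdot)$ if and only if $\theta\ge\theta^*$, where $\theta^*$ is determined by $$\frac{\varphi_F(\theta^* )}{\theta^*}=\frac{c}{p^S}.$$ Furthermore, when $\theta\ge\theta^*$, $$t^D(\theta,v)=t^*(\theta,v)-t_c,$$ where $$t_c=u^S(\theta^* )-u^*(\theta^* )\ge 0$$ is a constant that depends only on $\theta^*$.
   Context: Model. A seller produces a quantity $q\ge 0$ at constant marginal cost $c\ge 0$. A buyer with value $v$ who receives $q$ and pays $t$ has utility $u(v,q,t)=vq^{\alpha}-t$, with $\alpha\in(0,1)$. The seller's payoff is $t-qc$. In period 0 the buyer privately observes a signal $\theta\in[\underline\theta,\overline\theta]\subset\mathbb{R}_+$, with distribution $F$ and density $f$. Multiplicative values: in period 1 the buyer privately observes $v=\theta z$, where $z\sim H$ (density $h$) is independent of $\theta$. $G(\cdot\mid\theta)$ denotes the conditional distribution of $v$ given $\theta$, with density $g(\cdot\mid\theta)$, and $v$ ranges over $[\underline v,\overline v]$. Let $\varphi_F(\theta)=\theta-\frac{1-F(\theta)}{f(\theta)}$. The dynamic virtual value $\varphi(\theta,v)=v+\frac{1-F(\theta)}{f(\theta)}\cdot\frac{\partial G(v\mid\theta)/\partial\theta}{g(v\mid\theta)}$ then equals $z\varphi_F(\theta)=v\,\varphi_F(\theta)/\theta$. Standing assumptions. (1)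 $G(\cdot\mid\theta)$ is ordered in first order stochastic dominance by $\theta$, in the sense that $G(v\mid\theta)<G(v\mid\theta')$ for all $v$ and all $\theta'<\theta$. (2) Regularity, which in the multiplicative setting is the monotone hazard rate condition: $\frac{1-F(\theta)}{f(\theta)}$ is decreasing in $\theta$. Spot market. In period 1 buyers have access to a spot market which provides any quantity at constant unit price $p^S>c$. Buyers who sign a contract in period 0 are bound to it, but they do not sign contracts whose expected payoff is worse than participating in the future spot market. Constrained problem. A mechanism $(q,t)$ specifies $q(\theta,v)\ge0$ and $t(\theta,v)$ for each $(\theta,v)$. With $\mathrm{E}_v[\cdot\mid\theta]$ the expectation over $v\sim G(\cdot\mid\theta)$, the seller maximizes $\mathrm{E}_{\theta,v}[t(\theta,v)-q(\theta,v)c]$ subject to (IC0) $\mathrm{E}_v[u(v,q(\theta,v),t(\theta,v))\mid\theta]\ge\mathrm{E}_v[u(v,q(\theta',v),t(\theta',v))\mid\theta]$ for all $\theta,\theta'$; (IC1) $u(v,q(\theta,v),t(\theta,v))\ge u(v,q(\theta,v'),t(\theta,v'))$ for all $\theta,v,v'$; (spot-market participation) $\mathrm{E}_v[u(v,q(\theta,v),t(\theta,v))\mid\theta]\ge u^S(\theta):=\mathrm{E}_v\big[\max_q\{vq^{\alpha}-p^Sq\}\mid\theta\big]$ for all $\theta$. Benchmark. $(q^*,t^* )$ is the seller's optimal mechanism without a spot market, i.e. when the last constraint is replaced by expected utility $\ge0$ for all $\theta$. Explicitly, $q^*(\theta,v)=\left(\frac{\alpha}{c}\varphi(\theta,v)\mathbb{I}_{[\varphi(\theta,v)\ge0]}\right)^{1/(1-\alpha)}$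 and $t^*(\theta,v)=v\,q^*(\theta,v)^{\alpha}-u^*(\theta,v)$. Here $u^*(\theta,v)=u^*(\theta,\underline v)+\int_{\underline v}^{v}q^*(\theta,x)^{\alpha}dx$, and $u^*(\theta):=\mathrm{E}_v[u^*(\theta,v)\mid\theta]=-\int_{\underline\theta}^{\theta}\int_{\underline v}^{\overline v}q^*(x,v)^{\alpha}\frac{\partial G(v\mid x)}{\partial x}dv\,dx$. *)

theory Defs
  imports "HOL-Probability.Probability"
begin

text \<open>
  Primitives: signals in \<open>[th_lo, th_hi]\<close> with density \<open>sig_dens\<close>, and a multiplicative shock
  in \<open>[z_lo, z_hi]\<close> with density \<open>shock_dens\<close>; the value is signal times shock.
\<close>

record screening =
  alpha :: real
  cost :: real
  spot_price :: real
  th_lo :: real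
  th_hi :: real
  z_lo :: real
  z_hi :: real
  sig_dens :: "real \<Rightarrow> real"
  shock_dens :: "real \<Rightarrow> real"

definition signals :: "screening \<Rightarrow> real set" where
  "signals M = {th_lo M..th_hi M}"

definition v_lo :: "screening \<Rightarrow> real" where
  "v_lo M = th_lo M * z_lo M"

definition v_hi :: "screening \<Rightarrow> real" where
  "v_hi M = th_hi M * z_hi M"

definition vals :: "screening \<Rightarrow> real set" where
  "vals M = {v_lo M..v_hi M}"

text \<open>The interior of the set of values that type \<open>\<theta>\<close> can have; it varies with \<open>\<theta>\<close>.\<close>

definition type_vals :: "screening \<Rightarrow> real \<Rightarrow> real set" where
  "type_vals M \<theta> = {\<theta> * z_lo M<..<\<theta> * z_hi M}"

definition signal_law :: "screening \<Rightarrow> real measure" where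
  "signal_law M = density lborel (\<lambda>x. ennreal (sig_dens M x))"

definition shock_law :: "screening \<Rightarrow> real measure" where
  "shock_law M = density lborel (\<lambda>z. ennreal (shock_dens M z))"

text \<open>Conditional law of the value given the signal, and joint law of signal and value.\<close>

definition value_law :: "screening \<Rightarrow> real \<Rightarrow> real measure" where
  "value_law M \<theta> = distr (shock_law M) borel (\<lambda>z. \<theta> * z)"

definition joint_law :: "screening \<Rightarrow> (real \<times> real) measure" where
  "joint_law M =
     distr (signal_law M \<Otimes>\<^sub>M shock_law M) borel (\<lambda>(\<theta>, z). (\<theta>, \<theta> * z))"

definition sig_cdf :: "screening \<Rightarrow> real \<Rightarrow> real" where
  "sig_cdf M = cdf (signal_law M)"

definition val_cdf :: "screening \<Rightarrow> real \<Rightarrow> real \<Rightarrow> real" where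
  "val_cdf M \<theta> v = cdf (value_law M \<theta>) v"

text \<open>The density of \<open>value_law M \<theta>\<close> for \<open>\<theta> > 0\<close>, by change of variables.\<close>

definition val_dens :: "screening \<Rightarrow> real \<Rightarrow> real \<Rightarrow> real" where
  "val_dens M \<theta> v = shock_dens M (v / \<theta>) / \<theta>"

text \<open>
  Differentiability of the shock distribution with derivative \<open>shock_dens\<close> inside the support is
  what makes the partial derivative of \<open>val_cdf\<close> in the signal exist there; positivity makes
  the division by \<open>val_dens\<close> in the dynamic virtual value meaningful.

  Strict first order stochastic dominance cannot hold at values where both distribution functions
  are 0 or both are 1, and such values always exist when the support is bounded; it is
  required at all other values.

  The hazard rate condition concerns the signals at which the inverse hazard rate is defined; the
  density may vanish at the two endpoints only.
\<close>

locale screening_model =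
  fixes M :: screening
  assumes alpha: "0 < alpha M" "alpha M < 1"
    and cost: "0 \<le> cost M"
    and spot_price: "cost M < spot_price M"
    and signals: "0 \<le> th_lo M" "th_lo M < th_hi M"
    and shocks: "0 \<le> z_lo M" "z_lo M < z_hi M"
    and sig_dens_measurable: "sig_dens M \<in> borel_measurable borel"
    and sig_dens_nonneg: "\<And>x. 0 \<le> sig_dens M x"
    and sig_dens_pos: "\<And>x. x \<in> {th_lo M<..<th_hi M} \<Longrightarrow> 0 < sig_dens M x"
    and sig_dens_outside: "\<And>x. x \<notin> signals M \<Longrightarrow> sig_dens M x = 0"
    and sig_prob: "prob_space (signal_law M)"
    and shock_dens_measurable: "shock_dens M \<in> borel_measurable borel"
    and shock_dens_nonneg: "\<And>z. 0 \<le> shock_dens M z"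
    and shock_dens_pos: "\<And>z. z \<in> {z_lo M<..<z_hi M} \<Longrightarrow> 0 < shock_dens M z"
    and shock_dens_outside: "\<And>z. z \<notin> {z_lo M..z_hi M} \<Longrightarrow> shock_dens M z = 0"
    and shock_prob: "prob_space (shock_law M)"
    and shock_cdf_deriv: "\<And>z. z \<in> {z_lo M<..<z_hi M} \<Longrightarrow>
      (cdf (shock_law M) has_real_derivative shock_dens M z) (at z)"
    and stochastic_dominance: "\<And>\<theta>' \<theta> v. \<lbrakk>\<theta>' \<in> signals M; \<theta> \<in> signals M; \<theta>' < \<theta>;
      0 < val_cdf M \<theta>' v; val_cdf M \<theta> v < 1\<rbrakk> \<Longrightarrow> val_cdf M \<theta> v < val_cdf M \<theta>' v"
    and monotone_hazard_rate: "antimono_on {\<theta> \<in> signals M. 0 < sig_dens M \<theta>}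
      (\<lambda>\<theta>. (1 - sig_cdf M \<theta>) / sig_dens M \<theta>)"

definition virtual_type :: "screening \<Rightarrow> real \<Rightarrow> real" where
  "virtual_type M \<theta> = \<theta> - (1 - sig_cdf M \<theta>) / sig_dens M \<theta>"

definition virtual_value :: "screening \<Rightarrow> real \<Rightarrow> real \<Rightarrow> real" where
  "virtual_value M \<theta> v = v + (1 - sig_cdf M \<theta>) / sig_dens M \<theta> *
     (deriv (\<lambda>x. val_cdf M x v) \<theta> / val_dens M \<theta> v)"

definition utility :: "screening \<Rightarrow> real \<Rightarrow> real \<Rightarrow> real \<Rightarrow> real" where
  "utility M v q t = v * q powr alpha M - t"

definition spot_utility :: "screening \<Rightarrow> real \<Rightarrow> real" where
  "spot_utility M \<theta> =
     (LINT v|value_law M \<theta>. (SUP q\<in>{0..}. v * q powr alpha M - spot_price M * q))"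

subsection \<open>Mechanisms\<close>

text \<open>
  Only the behaviour on \<open>signals M \<times> vals M\<close> matters; requiring measurability on the
  whole plane is no restriction, as any measurable function there extends by 0. The
  utilities under the conditional expectations in \<open>IC0\<close> need no integrability assumption: by
  \<open>IC1\<close> they are monotone in the value on the compact interval \<open>vals M\<close>.
\<close>

definition mechanism :: "screening \<Rightarrow> (real \<Rightarrow> real \<Rightarrow> real) \<Rightarrow> (real \<Rightarrow> real \<Rightarrow> real) \<Rightarrow> bool" where
  "mechanism M q t \<longleftrightarrow>
     (\<lambda>(\<theta>, v). q \<theta> v) \<in> borel_measurable borel \<and>
     (\<lambda>(\<theta>, v). t \<theta> v) \<in> borel_measurable borel \<and>
     (\<forall>\<theta>\<in>signals M. \<forall>v\<in>vals M. 0 \<le> q \<theta> v) \<and>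
     integrable (joint_law M) (\<lambda>(\<theta>, v). t \<theta> v - q \<theta> v * cost M)"

definition payoff :: "screening \<Rightarrow> (real \<Rightarrow> real \<Rightarrow> real) \<Rightarrow> (real \<Rightarrow> real \<Rightarrow> real) \<Rightarrow> real" where
  "payoff M q t = (LINT (\<theta>, v)|joint_law M. t \<theta> v - q \<theta> v * cost M)"

definition IC0 :: "screening \<Rightarrow> (real \<Rightarrow> real \<Rightarrow> real) \<Rightarrow> (real \<Rightarrow> real \<Rightarrow> real) \<Rightarrow> bool" where
  "IC0 M q t \<longleftrightarrow> (\<forall>\<theta>\<in>signals M. \<forall>\<theta>'\<in>signals M.
     (LINT v|value_law M \<theta>. utility M v (q \<theta> v) (t \<theta> v))
       \<ge> (LINT v|value_law M \<theta>. utility M v (q \<theta>' v) (t \<theta>' v)))"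

definition IC1 :: "screening \<Rightarrow> (real \<Rightarrow> real \<Rightarrow> real) \<Rightarrow> (real \<Rightarrow> real \<Rightarrow> real) \<Rightarrow> bool" where
  "IC1 M q t \<longleftrightarrow> (\<forall>\<theta>\<in>signals M. \<forall>v\<in>vals M. \<forall>v'\<in>vals M.
     utility M v (q \<theta> v) (t \<theta> v) \<ge> utility M v (q \<theta> v') (t \<theta> v'))"

definition spot_participation ::
    "screening \<Rightarrow> (real \<Rightarrow> real \<Rightarrow> real) \<Rightarrow> (real \<Rightarrow> real \<Rightarrow> real) \<Rightarrow> bool" where
  "spot_participation M q t \<longleftrightarrow> (\<forall>\<theta>\<in>signals M.
     (LINT v|value_law M \<theta>. utility M v (q \<theta> v) (t \<theta> v)) \<ge> spot_utility M \<theta>)"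

definition feasible :: "screening \<Rightarrow> (real \<Rightarrow> real \<Rightarrow> real) \<Rightarrow> (real \<Rightarrow> real \<Rightarrow> real) \<Rightarrow> bool" where
  "feasible M q t \<longleftrightarrow> mechanism M q t \<and> IC0 M q t \<and> IC1 M q t \<and> spot_participation M q t"

text \<open>
  Optimal mechanisms are not unique as functions: allocations can be altered for a null set of
  signals, and for a given signal at values outside \<open>type_vals\<close>, without affecting feasibility or
  the payoff.
\<close>

definition optimal :: "screening \<Rightarrow> (real \<Rightarrow> real \<Rightarrow> real) \<Rightarrow> (real \<Rightarrow> real \<Rightarrow> real) \<Rightarrow> bool" where
  "optimal M q t \<longleftrightarrow> feasible M q t \<and> (\<forall>q' t'. feasible M q' t' \<longrightarrow> payoff M q' t' \<le> payoff M q t)"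

subsection \<open>The optimal mechanism without a spot market\<close>

definition q_star :: "screening \<Rightarrow> real \<Rightarrow> real \<Rightarrow> real" where
  "q_star M \<theta> v =
     (alpha M / cost M * virtual_value M \<theta> v * (if virtual_value M \<theta> v \<ge> 0 then 1 else 0))
       powr (1 / (1 - alpha M))"

definition u_star_exp :: "screening \<Rightarrow> real \<Rightarrow> real" where
  "u_star_exp M \<theta> =
     - (LINT x:{th_lo M..\<theta>}|lborel. (LINT v:vals M|lborel.
          q_star M x v powr alpha M * deriv (\<lambda>y. val_cdf M y v) x))"

text \<open>
  The lowest value's utility is the constant for which the conditional expectation of
  \<open>u_star M \<theta>\<close> is \<open>u_star_exp M \<theta>\<close>.
\<close>

definition u_star_lo :: "screening \<Rightarrow> real \<Rightarrow> real" where
  "u_star_lo M \<theta> = u_star_exp M \<theta> -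
     (LINT v|value_law M \<theta>. (LINT x:{v_lo M..v}|lborel. q_star M \<theta> x powr alpha M))"

definition u_star :: "screening \<Rightarrow> real \<Rightarrow> real \<Rightarrow> real" where
  "u_star M \<theta> v = u_star_lo M \<theta> + (LINT x:{v_lo M..v}|lborel. q_star M \<theta> x powr alpha M)"

definition t_star :: "screening \<Rightarrow> real \<Rightarrow> real \<Rightarrow> real" where
  "t_star M \<theta> v = v * q_star M \<theta> v powr alpha M - u_star M \<theta> v"

subsection \<open>The dynamic virtual value in the multiplicative model\<close>

lemma (in screening_model) val_cdf_eq:
  assumes "0 < \<theta>"
  shows "val_cdf M \<theta> v = cdf (shock_law M) (v / \<theta>)"
proof -
  have "(\<lambda>z. \<theta> * z) -` {..v} \<inter> space (shock_law M) = {..v / \<theta>}"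
    using assms by (auto simp: shock_law_def field_simps)
  then show ?thesis
    by (simp add: val_cdf_def value_law_def cdf_def measure_distr shock_law_def)
qed

lemma (in screening_model) val_cdf_deriv:
  assumes "0 < \<theta>" "v \<in> type_vals M \<theta>"
  shows "((\<lambda>x. val_cdf M x v) has_real_derivative - (v / \<theta>) * val_dens M \<theta> v) (at \<theta>)"
proof -
  have "v / \<theta> \<in> {z_lo M<..<z_hi M}"
    using assms by (auto simp: type_vals_def field_simps)
  then have H: "(cdf (shock_law M) has_real_derivative shock_dens M (v / \<theta>)) (at (v / \<theta>))"
    by (rule shock_cdf_deriv)
  have I: "((\<lambda>x. v / x) has_real_derivative - (v / \<theta>\<^sup>2)) (at \<theta>)"
    using assms by (auto intro!: derivative_eq_intros simp: power2_eq_square)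
  have "((\<lambda>x. cdf (shock_law M) (v / x)) has_real_derivative
      shock_dens M (v / \<theta>) * - (v / \<theta>\<^sup>2)) (at \<theta>)"
    using DERIV_chain2[OF H I] .
  then have "((\<lambda>x. cdf (shock_law M) (v / x)) has_real_derivative
      - (v / \<theta>) * val_dens M \<theta> v) (at \<theta>)"
    by (simp add: val_dens_def power2_eq_square mult.commute)
  then show ?thesis
    by (rule DERIV_cong_ev[THEN iffD1, rotated -1])
      (auto simp: val_cdf_eq eventually_nhds intro!: exI[of _ "{0<..}"] assms(1))
qed

lemma (in screening_model) virtual_value_eq:
  assumes "0 < \<theta>" "v \<in> type_vals M \<theta>"
  shows "virtual_value M \<theta> v = v * virtual_type M \<theta> / \<theta>"
proof -
  have "v / \<theta> \<in> {z_lo M<..<z_hi M}"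
    using assms by (auto simp: type_vals_def field_simps)
  then have "val_dens M \<theta> v \<noteq> 0"
    using shock_dens_pos[of "v / \<theta>"] assms by (auto simp: val_dens_def)
  then have "deriv (\<lambda>x. val_cdf M x v) \<theta> / val_dens M \<theta> v = - (v / \<theta>)"
    using DERIV_imp_deriv[OF val_cdf_deriv[OF assms]] by simp
  then show ?thesis
    using assms(1) unfolding virtual_value_def virtual_type_def
    by (simp add: right_diff_distrib diff_divide_distrib mult.commute)
qed

end

theory Submission
  imports Defs
begin

text \<open>
  Since \<open>v = \<theta> z\<close>, incentive compatibility makes the rent \<open>U\<close> of the buyer a convex function of the
  signal with subgradient \<open>Q(\<theta>) = E[z q(\<theta>, \<theta> z)^\<alpha>]\<close>. Put \<open>\<rho> = c / p\<^sup>S\<close> below \<open>\<theta>s\<close> and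
  \<open>\<rho> = \<phi>\<^sub>F(\<theta>) / \<theta>\<close> above, and let \<open>D\<close> be the difference between the rent of a feasible mechanism and
  that of the mechanism with allocation \<open>(\<alpha> \<rho> v / c)^(1 / (1 - \<alpha>))\<close> that leaves types below \<open>\<theta>s\<close>
  their spot utility. Participation gives \<open>D \<ge> 0\<close> below \<open>\<theta>s\<close>, and the hazard rate condition
  turns this, through the second mean value theorem for integrals, into
  \<open>E[D] \<ge> E[\<theta> (1 - \<rho>) D']\<close>. The profit gap is therefore at most the expected gap in the distorted
  surplus \<open>\<rho> v q^\<alpha> - c q\<close>, which the allocation above maximizes pointwise and uniquely. Hence an
  optimal allocation agrees with it for almost every signal, and then \<open>D = 0\<close> determines the
  payments. If \<open>c = 0\<close>, there is no optimum.
\<close>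

section \<open>Real analysis\<close>

text \<open>The spot utility is itself convex in the signal, a multiple of the power
  \<open>1 / (1 - \<alpha>)\<close> of \<theta>, so participation can bind on a whole interval of
  signals; fixing the rent of the lowest signal is not enough. The two values of \<rho> have
  different origins. A spot buyer purchases the quantity that maximizes \<rho> v q^\<alpha> - c q
  exactly when \<rho> is the ratio of cost to spot price, so this ratio reproduces the slope of a
  binding outside option. The other ratio comes from the inverse hazard rate, as in the problem
  without a spot market. The cutoff equation says where the two meet. The slope gap D' has no sign,
  so E[D] cannot be compared with E[\<theta> (1 - \<rho>) D'] pointwise. Their difference is D at
  the lowest signal plus the integral of (1 - F) D' against a weight that decreases from at most 1
  to 0 at the cutoff. Only the signs of D below the cutoff enter, and no differentiability of the
  density is required. All candidate allocations are powers of the value, so every expectation over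
  the shock reduces to one moment. Feasibility then becomes two conditions on a coefficient: it is
  nondecreasing in the signal and never below that of the spot market.\<close>

lemma powr_le_tangent:
  fixes y :: real
  assumes "0 < a" "a < 1" "0 \<le> y"
  shows "y powr a \<le> 1 + a * (y - 1)"
proof (cases "y = 0")
  case False
  then show ?thesis
    using Youngs_inequality_0[of a "1 - a" y 1] assms by (simp add: algebra_simps)
qed (use assms in auto)

lemma powr_eq_tangent:
  fixes y :: real
  assumes a: "0 < a" "a < 1" and y: "0 \<le> y" and eq: "y powr a = 1 + a * (y - 1)"
  shows "y = 1"
proof (rule ccontr)
  assume "y \<noteq> 1"
  define s where "s = sqrt y"
  have s: "0 \<le> s" "y = s * s" "s \<noteq> 1"
    using y \<open>y \<noteq> 1\<close> by (auto simp: s_def)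
  \<comment> \<open>Applying the tangent bound to the square root of \<open>y\<close> and squaring makes it strict.\<close>
  have "y powr a = (s powr a)\<^sup>2"
    by (simp add: s powr_mult power2_eq_square)
  also have "\<dots> \<le> (1 + a * (s - 1))\<^sup>2"
    using powr_le_tangent[OF a s(1)] by (intro power_mono) auto
  also have "\<dots> = 1 + a * (y - 1) - a * (1 - a) * (s - 1)\<^sup>2"
    by (simp add: s(2) power2_eq_square algebra_simps)
  also have "\<dots> < 1 + a * (y - 1)"
    using a s(3) by simp
  finally show False
    using eq by simp
qed

text \<open>Measured in units of the candidate, q = y qo, the first order condition x a qo^a = c qo
  turns the surplus into x qo^a (y^a - a y). By the tangent bound this is largest at y = 1 and
  nowhere else. The equality clause is the source of uniqueness of the optimal allocation.\<close>

lemma powr_surplus_le: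
  fixes x q c a :: real
  assumes a: "0 < a" "a < 1" and c: "0 < c" and x: "0 \<le> x" and q: "0 \<le> q"
  defines "qo \<equiv> (a * x / c) powr (1 / (1 - a))"
  shows "x * q powr a - c * q \<le> x * qo powr a - c * qo" (is "?L \<le> ?R")
    and "x * q powr a - c * q = x * qo powr a - c * qo \<Longrightarrow> q = qo"
proof -
  have "?L \<le> ?R \<and> (?L = ?R \<longrightarrow> q = qo)"
  proof (cases "x = 0")
    case True
    then show ?thesis using c q by (auto simp: qo_def)
  next
    case False
    then have x': "0 < x" using x by simp
    have qo: "0 < qo" using a c x' by (simp add: qo_def)
    have foc: "x * a * qo powr a = c * qo"
    proof -
      have "qo powr (1 - a) = a * x / c"
        using a c x' by (simp add: qo_def powr_powr)
      then have "qo powr a * (a * x / c) = qo"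
        using qo by (metis powr_add add.commute diff_add_cancel powr_one less_imp_le)
      then show ?thesis using c by (simp add: field_simps)
    qed
    define y where "y = q / qo"
    have y: "0 \<le> y" "q = y * qo" using q qo by (auto simp: y_def)
    have "?L = x * qo powr a * (y powr a - a * y)"
    proof -
      have "c * q = x * a * qo powr a * y" unfolding foc using y(2) by simp
      moreover have "q powr a = y powr a * qo powr a" using y qo by (simp add: powr_mult)
      ultimately show ?thesis by (simp only: right_diff_distrib mult_ac)
    qed
    moreover have "?R = x * qo powr a * (1 - a)"
      using foc by (simp add: algebra_simps)
    moreover have "0 < x * qo powr a" using x' qo by simp
    moreover have "y powr a - a * y \<le> 1 - a"
      using powr_le_tangent[OF a y(1)] by (simp add: algebra_simps)
    moreover have "y powr a - a * y = 1 - a \<Longrightarrow> y = 1"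
      using powr_eq_tangent[OF a y(1)] by (simp add: algebra_simps)
    ultimately show ?thesis
      using y(2) by (auto simp: mult_left_mono)
  qed
  then show "?L \<le> ?R" "?L = ?R \<Longrightarrow> q = qo" by auto
qed

text \<open>The maximal profit is homogeneous in x. With the spot price in place of \<open>c\<close>
  it evaluates the outside option.\<close>

lemma powr_surplus_max:
  fixes x c a :: real
  assumes a: "0 < a" "a < 1" and c: "0 < c" and x: "0 \<le> x"
  defines "qo \<equiv> (a * x / c) powr (1 / (1 - a))"
  shows "x * qo powr a - c * qo = (1 - a) * (a / c) powr (a / (1 - a)) * x powr (1 / (1 - a))"
proof (cases "x = 0")
  case False
  then have x: "0 < x" using x by simp
  have e: "1 / (1 - a) = 1 + a / (1 - a)" using a by (simp add: field_simps)
  have "qo = (a * x / c) * (a / c * x) powr (a / (1 - a))"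
    unfolding qo_def e powr_add using a c x by (simp add: mult_ac)
  moreover have "qo powr a = (a / c * x) powr (a / (1 - a))"
    unfolding qo_def by (simp add: powr_powr mult_ac)
  ultimately have "x * qo powr a - c * qo = (1 - a) * (x * (a / c * x) powr (a / (1 - a)))"
    using c by (simp add: field_simps)
  also have "\<dots> = (1 - a) * (a / c) powr (a / (1 - a)) * x powr (1 / (1 - a))"
    unfolding e powr_add powr_mult using x by simp
  finally show ?thesis .
qed (simp add: qo_def)

text \<open>This is the gradient inequality of a convex power. Its right side is a difference of
  maximal profits at cost \<open>c = a\<close>, a choice that makes the maximizer at x the pure
  power x^(1/(1-a)); keeping that quantity while x changes to y gives a lower bound. It later yields
  incentive compatibility in the value.\<close>

lemma powr_gradient_le:
  fixes x y a :: real
  assumes a: "0 < a" "a < 1" and "0 \<le> x" "0 \<le> y"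
  shows "(y - x) * x powr (a / (1 - a)) \<le> (1 - a) * (y powr (1 / (1 - a)) - x powr (1 / (1 - a)))"
proof -
  have e: "x powr (1 / (1 - a)) = x * x powr (a / (1 - a))"
  proof -
    have "1 / (1 - a) = 1 + a / (1 - a)" using a by (simp add: field_simps)
    then show ?thesis using assms(3) by (simp add: powr_add)
  qed
  have r: "(x powr (1 / (1 - a))) powr a = x powr (a / (1 - a))"
    by (simp add: powr_powr)
  have "y * x powr (a / (1 - a)) - a * x powr (1 / (1 - a))
      \<le> y * (y powr (1 / (1 - a))) powr a - a * y powr (1 / (1 - a))"
    using powr_surplus_le(1)[OF a a(1) assms(4), of "x powr (1 / (1 - a))"] a r by simp
  also have "\<dots> = (1 - a) * y powr (1 / (1 - a))"
    using powr_surplus_max[OF a a(1) assms(4)] a by simp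
  finally show ?thesis
    by (simp add: e algebra_simps)
qed

text \<open>A partition of mesh \<open>(b - a) / n\<close> bounds the increment by \<open>(b - a) / n * (Q b - Q a)\<close>.\<close>

lemma const_if_increment_le_product:
  fixes \<Phi> Q :: "real \<Rightarrow> real"
  assumes "a \<le> b"
    and inc: "\<And>x y. a \<le> x \<Longrightarrow> x \<le> y \<Longrightarrow> y \<le> b \<Longrightarrow> \<bar>\<Phi> y - \<Phi> x\<bar> \<le> (y - x) * (Q y - Q x)"
  shows "\<Phi> b = \<Phi> a"
proof (rule ccontr)
  assume "\<Phi> b \<noteq> \<Phi> a"
  have part: "\<bar>\<Phi> b - \<Phi> a\<bar> * real n \<le> (b - a) * (Q b - Q a)" if "0 < n" for n :: nat
  proof -
    define h where "h = (b - a) / real n"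
    define p where "p i = a + real i * h" for i
    have h: "0 \<le> h" "real n * h = b - a" using assms(1) that by (auto simp: h_def)
    have p: "a \<le> p i" "p i \<le> p (Suc i)" for i using h by (auto simp: p_def algebra_simps)
    have pb: "p i \<le> b" if "i \<le> n" for i
    proof -
      have "real i * h \<le> real n * h" using that h by (intro mult_right_mono) auto
      then show ?thesis using h by (simp add: p_def)
    qed
    have "\<bar>\<Phi> (p k) - \<Phi> a\<bar> \<le> h * (Q (p k) - Q a)" if "k \<le> n" for k
      using that
    proof (induction k)
      case 0
      then show ?case by (simp add: p_def)
    next
      case (Suc k)
      have "\<bar>\<Phi> (p (Suc k)) - \<Phi> (p k)\<bar> \<le> h * (Q (p (Suc k)) - Q (p k))"
      proof -
        have "p (Suc k) - p k = h" by (simp add: p_def algebra_simps)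
        then show ?thesis using inc[of "p k" "p (Suc k)"] p pb[OF Suc.prems] by simp
      qed
      then show ?case using Suc by (simp add: algebra_simps)
    qed
    from this[of n] have "\<bar>\<Phi> b - \<Phi> a\<bar> \<le> h * (Q b - Q a)"
      using h by (simp add: p_def)
    then have "\<bar>\<Phi> b - \<Phi> a\<bar> * real n \<le> h * (Q b - Q a) * real n"
      by (intro mult_right_mono) auto
    also have "\<dots> = (real n * h) * (Q b - Q a)" by (simp add: mult_ac)
    finally show ?thesis using h(2) by simp
  qed
  obtain n :: nat where n: "(b - a) * (Q b - Q a) / \<bar>\<Phi> b - \<Phi> a\<bar> < real n"
    using reals_Archimedean2 by blast
  have "(b - a) * (Q b - Q a) < real (Suc n) * \<bar>\<Phi> b - \<Phi> a\<bar>"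
    using n \<open>\<Phi> b \<noteq> \<Phi> a\<close> by (simp add: field_simps)
  then show False using part[of "Suc n"] by (simp add: mult.commute)
qed

text \<open>A set of full measure is dense. If f x < g x, a point of agreement slightly to the left
  of x has a value above f x, against monotonicity; the opposite case uses a point to the
  right.\<close>

lemma mono_AE_eq_continuous:
  fixes f g :: "real \<Rightarrow> real"
  assumes mono: "\<And>x y. a < x \<Longrightarrow> x \<le> y \<Longrightarrow> y < b \<Longrightarrow> f x \<le> f y"
    and cont: "continuous_on {a<..<b} g"
    and eq: "AE x in lborel. x \<in> {a<..<b} \<longrightarrow> f x = g x"
    and x: "x \<in> {a<..<b}"
  shows "f x = g x"
proof (rule ccontr)
  assume ne: "f x \<noteq> g x"
  have dense: "\<exists>y\<in>{l<..<u}. f y = g y" if "l < u" "a \<le> l" "u \<le> b" for l u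
  proof (rule ccontr)
    assume none: "\<not> ?thesis"
    have "AE y in lborel. y \<notin> {l<..<u}"
      using eq by eventually_elim (use that none in auto)
    then have "emeasure lborel {l<..<u} = 0"
      by (subst (asm) AE_iff_measurable[where N = "{l<..<u}"]) auto
    then show False using that by simp
  qed
  obtain \<delta> where \<delta>: "0 < \<delta>" "\<And>y. y \<in> {a<..<b} \<Longrightarrow> \<bar>y - x\<bar> < \<delta> \<Longrightarrow> \<bar>g y - g x\<bar> < \<bar>f x - g x\<bar>"
    using cont x ne unfolding continuous_on_iff dist_real_def
    by (metis abs_ge_zero less_le right_minus_eq zero_less_abs_iff)
  show False
  proof (cases "f x < g x")
    case True
    obtain y where y: "y \<in> {max a (x - \<delta>)<..<x}" "f y = g y"
      using dense[of "max a (x - \<delta>)" x] x \<delta>(1) by auto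
    then have "\<bar>g y - g x\<bar> < g x - f x" using \<delta>(2)[of y] x True by auto
    moreover have "f y \<le> f x" using mono[of y x] y x by auto
    ultimately show False using y(2) by linarith
  next
    case False
    obtain y where y: "y \<in> {x<..<min b (x + \<delta>)}" "f y = g y"
      using dense[of x "min b (x + \<delta>)"] x \<delta>(1) by auto
    then have "\<bar>g y - g x\<bar> < f x - g x" using \<delta>(2)[of y] x False by auto
    moreover have "f x \<le> f y" using mono[of x y] y x by auto
    ultimately show False using y(2) by linarith
  qed
qed

section \<open>Integrals over compact intervals and the envelope formula\<close>

lemma set_integrable_bounded_on:
  fixes f :: "real \<Rightarrow> real"
  assumes "f \<in> borel_measurable borel" "\<And>x. x \<in> {a..b} \<Longrightarrow> \<bar>f x\<bar> \<le> B"
    and "a \<le> x" "y \<le> b"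
  shows "set_integrable lborel {x..y} f"
  unfolding set_integrable_def
proof (rule integrableI_bounded_set[where A = "{x..y}" and B = B])
  show "AE u in lborel. u \<in> {x..y} \<longrightarrow> norm (indicat_real {x..y} u *\<^sub>R f u) \<le> B"
    using assms by auto
qed (use assms in \<open>auto simp: emeasure_lborel_Icc_eq\<close>)

lemma set_integral_Icc_combine:
  fixes f :: "real \<Rightarrow> real"
  assumes "set_integrable lborel {a..c} f" "a \<le> b" "b \<le> c"
  shows "(LINT x:{a..c}|lborel. f x) = (LINT x:{a..b}|lborel. f x) + (LINT x:{b..c}|lborel. f x)"
proof -
  have "set_integrable lborel {a..b} f" "set_integrable lborel {b..c} f"
    using assms by (auto intro: set_integrable_subset)
  moreover have "AE x in lborel. \<not> (x \<in> {a..b} \<and> x \<in> {b..c})"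
    using AE_lborel_singleton[of b] by eventually_elim auto
  ultimately have "(LINT x:{a..b} \<union> {b..c}|lborel. f x) =
      (LINT x:{a..b}|lborel. f x) + (LINT x:{b..c}|lborel. f x)"
    by (intro set_integral_Un_AE) auto
  moreover have "{a..b} \<union> {b..c} = {a..c}" using assms by auto
  ultimately show ?thesis by simp
qed

lemma set_integral_Icc_const:
  assumes "x \<le> y"
  shows "(LINT u:{x..y}|lborel. (c::real)) = c * (y - x)"
  using assms by (simp add: set_lebesgue_integral_def mult.commute)

text \<open>Both the increment of U and the integral of Q over [x, y] lie between (y - x) Q x and (y
  - x) Q y. Their difference therefore has increments of the form handled by
  \<open>const_if_increment_le_product\<close>, so the envelope formula follows without
  differentiating U.\<close>

lemma subgradient_integral:
  fixes U Q :: "real \<Rightarrow> real"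
  assumes meas: "Q \<in> borel_measurable borel" and "a \<le> b"
    and sub: "\<And>x y. x \<in> {a..b} \<Longrightarrow> y \<in> {a..b} \<Longrightarrow> U x + (y - x) * Q x \<le> U y"
  shows "U b = U a + (LINT x:{a..b}|lborel. Q x)"
proof -
  have mono: "Q x \<le> Q y" if "x \<in> {a..b}" "y \<in> {a..b}" "x \<le> y" for x y
  proof (cases "x = y")
    case False
    have "(y - x) * Q x \<le> (y - x) * Q y"
      using sub[OF that(1,2)] sub[OF that(2,1)] by (simp add: algebra_simps)
    then show ?thesis using that False by simp
  qed simp
  have int: "set_integrable lborel {x..y} Q" if "a \<le> x" "y \<le> b" for x y
  proof (rule set_integrable_bounded_on[OF meas _ that])
    show "\<bar>Q u\<bar> \<le> max \<bar>Q a\<bar> \<bar>Q b\<bar>" if "u \<in> {a..b}" for u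
      using mono[of a u] mono[of u b] that assms(2) by auto
  qed
  define \<Phi> where "\<Phi> y = U y - (LINT x:{a..y}|lborel. Q x)" for y
  have "\<Phi> b = \<Phi> a"
  proof (rule const_if_increment_le_product[OF assms(2)])
    fix x y assume xy: "a \<le> x" "x \<le> y" "y \<le> b"
    have split: "(LINT u:{a..y}|lborel. Q u) = (LINT u:{a..x}|lborel. Q u) + (LINT u:{x..y}|lborel. Q u)"
      using xy int by (intro set_integral_Icc_combine) auto
    have ic: "set_integrable lborel {x..y} (\<lambda>_. c)" for c :: real
      by (rule set_integrable_bounded_on[where B = "\<bar>c\<bar>"]) (use xy in auto)
    have "(LINT u:{x..y}|lborel. Q x) \<le> (LINT u:{x..y}|lborel. Q u)"
      using xy by (intro set_integral_mono ic int mono) auto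
    moreover have "(LINT u:{x..y}|lborel. Q u) \<le> (LINT u:{x..y}|lborel. Q y)"
      using xy by (intro set_integral_mono ic int mono) auto
    ultimately show "\<bar>\<Phi> y - \<Phi> x\<bar> \<le> (y - x) * (Q y - Q x)"
      using xy sub[of x y] sub[of y x] split
      by (simp add: \<Phi>_def set_integral_Icc_const algebra_simps abs_le_iff)
  qed
  moreover have "(LINT x:{a..a}|lborel. Q x) = 0"
    using set_integral_at_point[of lborel a Q] int[of a a] assms(2) by simp
  ultimately show ?thesis by (simp add: \<Phi>_def)
qed

lemma powr_integral:
  fixes r :: real
  assumes "0 \<le> r" "0 \<le> a" "a \<le> b"
  shows "(LINT x:{a..b}|lborel. x powr r) = (b powr (r + 1) - a powr (r + 1)) / (r + 1)"
proof -
  have "set_integrable lborel {a..b} (\<lambda>x. x powr r)"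
    using assms
    by (intro set_integrable_bounded_on[where B = "b powr r" and a = a and b = b])
      (auto intro: powr_mono2)
  then have "(LINT x:{a..b}|lborel. x powr r) = integral {a..b} (\<lambda>x. x powr r)"
    by (simp add: set_borel_integral_eq_integral)
  moreover have "((\<lambda>x. x powr r) has_integral (b powr (r + 1) / (r + 1) - a powr (r + 1) / (r + 1))) {a..b}"
  proof (rule fundamental_theorem_of_calculus_interior)
    show "continuous_on {a..b} (\<lambda>x. x powr (r + 1) / (r + 1))"
      using assms by (intro continuous_intros continuous_on_powr') auto
    show "((\<lambda>x. x powr (r + 1) / (r + 1)) has_vector_derivative x powr r) (at x)"
      if "x \<in> {a<..<b}" for x
      using that assms
      by (auto intro!: derivative_eq_intros simp: has_real_derivative_iff_has_vector_derivative[symmetric])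
  qed (use assms in auto)
  ultimately show ?thesis
    by (simp add: integral_unique diff_divide_distrib)
qed

text \<open>Since m decreases to 0, the second mean value theorem, applied to the increasing
  function -m, writes the weighted integral as m a times the integral of g over some initial
  segment. That segment contributes at least -k, and m a lies between 0 and 1.\<close>

lemma weighted_integral_ge:
  fixes g m :: "real \<Rightarrow> real"
  assumes "a \<le> b" and g: "set_integrable lborel {a..b} g" and m: "m \<in> borel_measurable borel"
    and anti: "\<And>x y. a \<le> x \<Longrightarrow> x \<le> y \<Longrightarrow> y \<le> b \<Longrightarrow> m y \<le> m x"
    and "m b = 0" "m a \<le> 1"
    and "0 \<le> k" and part: "\<And>y. y \<in> {a..b} \<Longrightarrow> - k \<le> (LINT x:{a..y}|lborel. g x)"
  shows "set_integrable lborel {a..b} (\<lambda>x. m x * g x)"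
    and "- k \<le> (LINT x:{a..b}|lborel. m x * g x)"
proof -
  have bd: "\<bar>m x\<bar> \<le> m a" if "x \<in> {a..b}" for x
    using anti[of a x] anti[of x b] that assms(5) by auto
  show int: "set_integrable lborel {a..b} (\<lambda>x. m x * g x)"
  proof -
    have "set_integrable lborel {a..b} (\<lambda>x. m a * g x)" using g by simp
    then show ?thesis
    proof (rule set_integrable_bound)
      have "set_borel_measurable lborel {a..b} g"
        using g by (auto simp: set_integrable_def set_borel_measurable_def)
      then have "(\<lambda>x. m x * (indicat_real {a..b} x *\<^sub>R g x)) \<in> borel_measurable lborel"
        using m unfolding set_borel_measurable_def by measurable
      then show "set_borel_measurable lborel {a..b} (\<lambda>x. m x * g x)"
        unfolding set_borel_measurable_def by (simp add: mult_ac)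
      show "AE x in lborel. x \<in> {a..b} \<longrightarrow> norm (m x * g x) \<le> norm (m a * g x)"
        using bd by (force simp: abs_mult intro!: mult_right_mono)
    qed
  qed
  have "g integrable_on {a..b}"
    using set_borel_integral_eq_integral(1)[OF g] .
  then obtain c where c: "c \<in> {a..b}"
    "integral {a..b} (\<lambda>x. - m x * g x) = - m a * integral {a..c} g + - m b * integral {c..b} g"
    using second_mean_value_theorem[of g a b "\<lambda>x. - m x"] assms(1) anti by auto
  have "integral {a..c} g = (LINT x:{a..c}|lborel. g x)"
    using c(1) set_integrable_subset[OF g, of "{a..c}"]
    by (intro set_borel_integral_eq_integral(2)[symmetric]) auto
  then have "(LINT x:{a..b}|lborel. m x * g x) = m a * (LINT x:{a..c}|lborel. g x)"
    using c(2) set_borel_integral_eq_integral(2)[OF int] assms(5) by simp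
  moreover have "0 \<le> m a" using anti[of a b] assms(1,5) by simp
  then have "m a * (- k) \<le> m a * (LINT x:{a..c}|lborel. g x)"
    using part[OF c(1)] by (rule mult_left_mono[rotated])
  moreover have "- k \<le> m a * (- k)"
    using assms(6,7) by (simp add: mult_left_le_one_le \<open>0 \<le> m a\<close>)
  ultimately show "- k \<le> (LINT x:{a..b}|lborel. m x * g x)" by simp
qed

section \<open>The laws of signal and shock\<close>

sublocale screening_model \<subseteq> signal: prob_space "signal_law M"
  by (rule sig_prob)

sublocale screening_model \<subseteq> shock: prob_space "shock_law M"
  by (rule shock_prob)

sublocale screening_model \<subseteq> pair: pair_prob_space "signal_law M" "shock_law M" ..

context screening_model
begin

lemma sets_signal_law [simp, measurable_cong]: "sets (signal_law M) = sets borel"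
  by (simp add: signal_law_def)

lemma space_signal_law [simp]: "space (signal_law M) = UNIV"
  by (simp add: signal_law_def)

lemma sets_shock_law [simp, measurable_cong]: "sets (shock_law M) = sets borel"
  by (simp add: shock_law_def)

lemma space_shock_law [simp]: "space (shock_law M) = UNIV"
  by (simp add: shock_law_def)

text \<open>The density is positive on the open interval and zero outside the closed one; at the
  endpoints it is unconstrained, but they are Lebesgue null. So the law has the null sets of
  Lebesgue measure on the open interval.\<close>

lemma AE_signal_law_iff:
  "(AE \<theta> in signal_law M. P \<theta>) \<longleftrightarrow> (AE \<theta> in lborel. \<theta> \<in> {th_lo M<..<th_hi M} \<longrightarrow> P \<theta>)"
proof -
  have "AE \<theta> in lborel. (0 < sig_dens M \<theta>) = (\<theta> \<in> {th_lo M<..<th_hi M})"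
    using AE_lborel_singleton[of "th_lo M"] AE_lborel_singleton[of "th_hi M"]
  proof eventually_elim
    case (elim \<theta>)
    then show ?case
      using sig_dens_pos[of \<theta>] sig_dens_outside[of \<theta>] by (force simp: signals_def)
  qed
  then have "(AE \<theta> in lborel. 0 < sig_dens M \<theta> \<longrightarrow> P \<theta>) \<longleftrightarrow>
      (AE \<theta> in lborel. \<theta> \<in> {th_lo M<..<th_hi M} \<longrightarrow> P \<theta>)"
    by (intro eventually_subst) (auto elim!: eventually_mono)
  then show ?thesis
    unfolding signal_law_def using sig_dens_measurable by (subst AE_density) simp_all
qed

lemma AE_shock_law_iff:
  "(AE z in shock_law M. P z) \<longleftrightarrow> (AE z in lborel. z \<in> {z_lo M<..<z_hi M} \<longrightarrow> P z)"
proof -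
  have "AE z in lborel. (0 < shock_dens M z) = (z \<in> {z_lo M<..<z_hi M})"
    using AE_lborel_singleton[of "z_lo M"] AE_lborel_singleton[of "z_hi M"]
  proof eventually_elim
    case (elim z)
    then show ?case
      using shock_dens_pos[of z] shock_dens_outside[of z] by force
  qed
  then have "(AE z in lborel. 0 < shock_dens M z \<longrightarrow> P z) \<longleftrightarrow>
      (AE z in lborel. z \<in> {z_lo M<..<z_hi M} \<longrightarrow> P z)"
    by (intro eventually_subst) (auto elim!: eventually_mono)
  then show ?thesis
    unfolding shock_law_def using shock_dens_measurable by (subst AE_density) simp_all
qed

lemma AE_signal: "AE \<theta> in signal_law M. \<theta> \<in> {th_lo M<..<th_hi M}"
  by (simp add: AE_signal_law_iff)

lemma AE_shock: "AE z in shock_law M. z \<in> {z_lo M<..<z_hi M}"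
  by (simp add: AE_shock_law_iff)

lemma integrable_signal_bounded:
  fixes f :: "real \<Rightarrow> real"
  assumes "f \<in> borel_measurable borel" "\<And>\<theta>. \<theta> \<in> signals M \<Longrightarrow> \<bar>f \<theta>\<bar> \<le> B"
  shows "integrable (signal_law M) f"
proof (rule signal.integrable_const_bound[where B = B])
  show "AE \<theta> in signal_law M. norm (f \<theta>) \<le> B"
    using AE_signal by eventually_elim (use assms(2) in \<open>auto simp: signals_def\<close>)
qed (use assms in auto)

lemma integrable_shock_bounded:
  fixes f :: "real \<Rightarrow> real"
  assumes "f \<in> borel_measurable borel" "\<And>z. z \<in> {z_lo M..z_hi M} \<Longrightarrow> \<bar>f z\<bar> \<le> B"
  shows "integrable (shock_law M) f"
proof (rule shock.integrable_const_bound[where B = B])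
  show "AE z in shock_law M. norm (f z) \<le> B"
    using AE_shock by eventually_elim (use assms(2) in auto)
qed (use assms in auto)

lemma integral_shock_mono:
  fixes f g :: "real \<Rightarrow> real"
  assumes "integrable (shock_law M) f" "integrable (shock_law M) g"
    and "\<And>z. z \<in> {z_lo M<..<z_hi M} \<Longrightarrow> f z \<le> g z"
  shows "(LINT z|shock_law M. f z) \<le> (LINT z|shock_law M. g z)"
  using assms(1,2)
proof (rule integral_mono_AE)
  show "AE z in shock_law M. f z \<le> g z"
    using AE_shock by eventually_elim (rule assms(3))
qed

lemma integral_shock_cong:
  fixes f g :: "real \<Rightarrow> real"
  assumes "f \<in> borel_measurable borel" "g \<in> borel_measurable borel"
    and "\<And>z. z \<in> {z_lo M<..<z_hi M} \<Longrightarrow> f z = g z"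
  shows "(LINT z|shock_law M. f z) = (LINT z|shock_law M. g z)"
proof (rule integral_cong_AE)
  show "AE z in shock_law M. f z = g z"
    using AE_shock by eventually_elim (rule assms(3))
qed (use assms in auto)

lemma integral_signal_eq:
  fixes f :: "real \<Rightarrow> real"
  assumes "f \<in> borel_measurable borel"
  shows "(LINT \<theta>|signal_law M. f \<theta>) = (LINT \<theta>:signals M|lborel. f \<theta> * sig_dens M \<theta>)"
    and "integrable (signal_law M) f \<longleftrightarrow> set_integrable lborel (signals M) (\<lambda>\<theta>. f \<theta> * sig_dens M \<theta>)"
proof -
  have eq: "indicat_real (signals M) \<theta> *\<^sub>R (f \<theta> * sig_dens M \<theta>) = sig_dens M \<theta> * f \<theta>" for \<theta>
    by (cases "\<theta> \<in> signals M") (simp_all add: sig_dens_outside)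
  show "(LINT \<theta>|signal_law M. f \<theta>) = (LINT \<theta>:signals M|lborel. f \<theta> * sig_dens M \<theta>)"
    unfolding set_lebesgue_integral_def eq signal_law_def
    using assms sig_dens_measurable sig_dens_nonneg by (intro integral_real_density) auto
  show "integrable (signal_law M) f \<longleftrightarrow> set_integrable lborel (signals M) (\<lambda>\<theta>. f \<theta> * sig_dens M \<theta>)"
    unfolding set_integrable_def eq signal_law_def
    using assms sig_dens_measurable sig_dens_nonneg by (intro integrable_real_density) auto
qed

lemma integral_shock_eq:
  fixes f :: "real \<Rightarrow> real"
  assumes "f \<in> borel_measurable borel"
  shows "(LINT z|shock_law M. f z) = (LINT z|lborel. f z * shock_dens M z)"
  unfolding shock_law_def
  using integral_real_density[of "shock_dens M" lborel f] assms shock_dens_measurable shock_dens_nonneg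
  by (simp add: mult.commute)

lemma sig_cdf_bounds: "0 \<le> sig_cdf M \<theta>" "sig_cdf M \<theta> \<le> 1"
  by (auto simp: sig_cdf_def cdf_def)

text \<open>The law has no atoms, so the open half line can be replaced by the closed one, which is
  the set that an exchange of integrals produces.\<close>

lemma sig_cdf_compl: "1 - sig_cdf M \<theta> = signal.prob {\<theta>..}"
proof -
  have "1 - sig_cdf M \<theta> = signal.prob {\<theta><..}"
  proof -
    have "signal.prob (space (signal_law M) - {..\<theta>}) = 1 - signal.prob {..\<theta>}"
      by (rule signal.prob_compl) simp
    moreover have "space (signal_law M) - {..\<theta>} = {\<theta><..}" by auto
    ultimately show ?thesis by (simp add: sig_cdf_def cdf_def)
  qed
  also have "\<dots> = signal.prob {\<theta>..}"
  proof (rule signal.finite_measure_eq_AE)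
    show "AE x in signal_law M. x \<in> {\<theta><..} \<longleftrightarrow> x \<in> {\<theta>..}"
      using AE_lborel_singleton[of \<theta>] by (simp add: AE_signal_law_iff, eventually_elim) auto
  qed auto
  finally show ?thesis .
qed

lemma sig_cdf_mono: "x \<le> y \<Longrightarrow> sig_cdf M x \<le> sig_cdf M y"
  unfolding sig_cdf_def cdf_def by (intro signal.finite_measure_mono) auto

lemma sig_cdf_measurable [measurable]: "sig_cdf M \<in> borel_measurable borel"
  by (intro borel_measurable_mono monoI sig_cdf_mono)

lemma sig_cdf_less_1:
  assumes "\<theta> < th_hi M"
  shows "sig_cdf M \<theta> < 1"
proof (rule ccontr)
  assume "\<not> ?thesis"
  then have "signal.prob {\<theta>..} = 0"
    using sig_cdf_compl[of \<theta>] sig_cdf_bounds[of \<theta>] by simp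
  then have "AE x in signal_law M. x \<notin> {\<theta>..}"
    by (simp add: signal.prob_eq_0)
  then have "AE x in lborel. x \<notin> {max \<theta> (th_lo M)<..<th_hi M}"
    unfolding AE_signal_law_iff by eventually_elim auto
  then have "emeasure lborel {max \<theta> (th_lo M)<..<th_hi M} = 0"
    by (subst (asm) AE_iff_measurable[where N = "{max \<theta> (th_lo M)<..<th_hi M}"]) auto
  then show False
    using assms signals by (simp add: emeasure_lborel_Ioo)
qed

lemma sig_cdf_th_hi: "sig_cdf M (th_hi M) = 1"
proof -
  have "signal.prob {th_hi M..} = 0"
    using AE_signal by (subst signal.prob_eq_0) (auto elim!: eventually_rev_mp)
  then show ?thesis using sig_cdf_compl[of "th_hi M"] by simp
qed

lemma AE_lborel_if_AE_signal:
  assumes "AE \<theta> in signal_law M. P \<theta>"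
  shows "AE \<theta> in lborel. \<theta> \<in> signals M \<longrightarrow> P \<theta>"
  using assms AE_lborel_singleton[of "th_lo M"] AE_lborel_singleton[of "th_hi M"]
  unfolding AE_signal_law_iff by eventually_elim (auto simp: signals_def)

lemma v_in_vals:
  assumes "\<theta> \<in> signals M" "z \<in> {z_lo M..z_hi M}"
  shows "\<theta> * z \<in> vals M"
  using assms signals shocks
  by (auto simp: signals_def vals_def v_lo_def v_hi_def intro!: mult_mono)

lemma vals_nonneg: "v \<in> vals M \<Longrightarrow> 0 \<le> v"
  using signals shocks unfolding vals_def v_lo_def
  by (meson atLeastAtMost_iff mult_nonneg_nonneg order_trans)

lemma v_hi_in_vals: "v_hi M \<in> vals M"
  using v_in_vals[of "th_hi M" "z_hi M"] signals shocks by (simp add: signals_def v_hi_def)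

lemma v_lo_in_vals: "v_lo M \<in> vals M"
  using v_in_vals[of "th_lo M" "z_lo M"] signals shocks by (simp add: signals_def v_lo_def)

lemma integral_value_law:
  fixes g :: "real \<Rightarrow> real"
  assumes "g \<in> borel_measurable borel"
  shows "(LINT v|value_law M \<theta>. g v) = (LINT z|shock_law M. g (\<theta> * z))"
  unfolding value_law_def using assms by (intro integral_distr) auto

end

section \<open>Incentive compatible mechanisms\<close>

context screening_model
begin

text \<open>Type \<open>\<theta>\<close> reports \<open>\<theta>'\<close> and then reports its value
  truthfully, even where that value is impossible for \<open>\<theta>'\<close>. Integrating over the
  shock puts all types on one probability space.\<close>

definition gross_rent ::
    "(real \<Rightarrow> real \<Rightarrow> real) \<Rightarrow> (real \<Rightarrow> real \<Rightarrow> real) \<Rightarrow> real \<Rightarrow> real \<Rightarrow> real" where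
  "gross_rent q t \<theta>' \<theta> =
     (LINT z|shock_law M. utility M (\<theta> * z) (q \<theta>' (\<theta> * z)) (t \<theta>' (\<theta> * z)))"

abbreviation rent :: "(real \<Rightarrow> real \<Rightarrow> real) \<Rightarrow> (real \<Rightarrow> real \<Rightarrow> real) \<Rightarrow> real \<Rightarrow> real" where
  "rent q t \<theta> \<equiv> gross_rent q t \<theta> \<theta>"

definition slope :: "(real \<Rightarrow> real \<Rightarrow> real) \<Rightarrow> real \<Rightarrow> real" where
  "slope q \<theta> = (LINT z|shock_law M. z * q \<theta> (\<theta> * z) powr alpha M)"

definition surplus :: "(real \<Rightarrow> real \<Rightarrow> real) \<Rightarrow> real \<Rightarrow> real" where
  "surplus q \<theta> =
     (LINT z|shock_law M. \<theta> * z * q \<theta> (\<theta> * z) powr alpha M - cost M * q \<theta> (\<theta> * z))"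

lemma measurable_section:
  fixes f :: "real \<Rightarrow> real \<Rightarrow> real"
  assumes "(\<lambda>(x, y). f x y) \<in> borel_measurable borel"
    and "g \<in> borel_measurable N" "h \<in> borel_measurable N"
  shows "(\<lambda>x. f (g x) (h x)) \<in> borel_measurable N"
  using measurable_compose[OF borel_measurable_Pair[OF assms(2,3)] assms(1)] by simp

lemma measurable_shock_integral:
  fixes f :: "real \<Rightarrow> real \<Rightarrow> real"
  assumes "(\<lambda>(x, z). f x z) \<in> borel_measurable (borel \<Otimes>\<^sub>M borel)"
  shows "(\<lambda>x. LINT z|shock_law M. f x z) \<in> borel_measurable borel"
proof -
  have "(\<lambda>(x, z). f x z) \<in> borel_measurable (borel \<Otimes>\<^sub>M shock_law M)"
    using assms unfolding measurable_cong_sets[OF sets_pair_measure_cong[OF refl sets_shock_law] refl] .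
  then show ?thesis by (rule shock.borel_measurable_lebesgue_integral)
qed

context
  fixes q t :: "real \<Rightarrow> real \<Rightarrow> real"
  assumes mech: "mechanism M q t"
begin

lemma measurable_q:
  "g \<in> borel_measurable N \<Longrightarrow> h \<in> borel_measurable N \<Longrightarrow> (\<lambda>x. q (g x) (h x)) \<in> borel_measurable N"
  using mech by (auto intro: measurable_section[of q] measurable_section[of t] simp: mechanism_def)

lemma measurable_t:
  "g \<in> borel_measurable N \<Longrightarrow> h \<in> borel_measurable N \<Longrightarrow> (\<lambda>x. t (g x) (h x)) \<in> borel_measurable N"
  using mech by (auto intro: measurable_section[of q] measurable_section[of t] simp: mechanism_def)

lemma q_nonneg: "\<theta> \<in> signals M \<Longrightarrow> v \<in> vals M \<Longrightarrow> 0 \<le> q \<theta> v"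
  using mech by (auto simp: mechanism_def)

lemma measurable_slope [measurable]: "slope q \<in> borel_measurable borel"
  supply [measurable (raw)] = measurable_q measurable_t
  unfolding slope_def by (rule measurable_shock_integral) measurable

lemma measurable_surplus [measurable]: "surplus q \<in> borel_measurable borel"
  supply [measurable (raw)] = measurable_q measurable_t
  unfolding surplus_def by (rule measurable_shock_integral) measurable

lemma measurable_rent [measurable]: "rent q t \<in> borel_measurable borel"
  supply [measurable (raw)] = measurable_q measurable_t
  unfolding gross_rent_def utility_def by (rule measurable_shock_integral) measurable

lemma gross_rent_eq:
  "(LINT v|value_law M \<theta>. utility M v (q \<theta>' v) (t \<theta>' v)) = gross_rent q t \<theta>' \<theta>"
  supply [measurable (raw)] = measurable_q measurable_t
  unfolding gross_rent_def utility_def by (rule integral_value_law) measurable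

section \<open>Consequences of incentive compatibility in the value\<close>

context
  assumes ic1: "IC1 M q t"
begin

text \<open>A buyer with value v' who reports v gets the utility of v plus (v' - v) q^\<alpha>,
  because utility is affine in the value once the report is fixed.\<close>

lemma utility_subgradient:
  assumes "\<theta> \<in> signals M" "v \<in> vals M" "v' \<in> vals M"
  shows "utility M v (q \<theta> v) (t \<theta> v) + (v' - v) * q \<theta> v powr alpha M
    \<le> utility M v' (q \<theta> v') (t \<theta> v')"
  using ic1 assms unfolding IC1_def utility_def by (force simp: algebra_simps)

lemma q_powr_mono:
  assumes "\<theta> \<in> signals M" "v \<in> vals M" "v' \<in> vals M" "v \<le> v'"
  shows "q \<theta> v powr alpha M \<le> q \<theta> v' powr alpha M"
proof (cases "v = v'")
  case False
  have "(v' - v) * q \<theta> v powr alpha M \<le> (v' - v) * q \<theta> v' powr alpha M"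
    using utility_subgradient[OF assms(1,2,3)] utility_subgradient[OF assms(1,3,2)]
    by (simp add: algebra_simps)
  then show ?thesis using assms(4) False by simp
qed simp

lemma q_mono:
  assumes "\<theta> \<in> signals M" "v \<in> vals M" "v' \<in> vals M" "v \<le> v'"
  shows "q \<theta> v \<le> q \<theta> v'"
proof (rule ccontr)
  assume "\<not> ?thesis"
  then have "q \<theta> v' powr alpha M < q \<theta> v powr alpha M"
    using alpha q_nonneg assms by (intro powr_less_mono2) auto
  then show False using q_powr_mono[OF assms] by simp
qed

lemma in_vals_le_v_hi: "v \<in> vals M \<Longrightarrow> v \<le> v_hi M"
  by (simp add: vals_def)

lemma integrable_q:
  assumes "\<theta>' \<in> signals M" "\<theta> \<in> signals M"
  shows "integrable (shock_law M) (\<lambda>z. q \<theta>' (\<theta> * z))"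
  supply [measurable (raw)] = measurable_q measurable_t
proof (rule integrable_shock_bounded)
  show "\<bar>q \<theta>' (\<theta> * z)\<bar> \<le> q \<theta>' (v_hi M)" if "z \<in> {z_lo M..z_hi M}" for z
    using v_in_vals[OF assms(2) that] q_mono[OF assms(1)] q_nonneg[OF assms(1)]
      v_hi_in_vals in_vals_le_v_hi by (simp add: abs_of_nonneg)
qed measurable

lemma integrable_q_powr:
  assumes "\<theta>' \<in> signals M" "\<theta> \<in> signals M"
  shows "integrable (shock_law M) (\<lambda>z. z * q \<theta>' (\<theta> * z) powr alpha M)"
  supply [measurable (raw)] = measurable_q measurable_t
proof (rule integrable_shock_bounded)
  show "\<bar>z * q \<theta>' (\<theta> * z) powr alpha M\<bar> \<le> z_hi M * q \<theta>' (v_hi M) powr alpha M"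
    if "z \<in> {z_lo M..z_hi M}" for z
    using v_in_vals[OF assms(2) that] q_powr_mono[OF assms(1)] that shocks
      v_hi_in_vals in_vals_le_v_hi by (auto simp: abs_mult intro!: mult_mono)
qed measurable

lemma integrable_utility:
  assumes "\<theta>' \<in> signals M" "\<theta> \<in> signals M"
  shows "integrable (shock_law M) (\<lambda>z. utility M (\<theta> * z) (q \<theta>' (\<theta> * z)) (t \<theta>' (\<theta> * z)))"
  supply [measurable (raw)] = measurable_q measurable_t
proof (rule integrable_shock_bounded)
  let ?w = "\<lambda>v. utility M v (q \<theta>' v) (t \<theta>' v)"
  have mono: "?w v \<le> ?w v'" if "v \<in> vals M" "v' \<in> vals M" "v \<le> v'" for v v'
  proof -
    have "0 \<le> (v' - v) * q \<theta>' v powr alpha M" using that by simp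
    then show ?thesis using utility_subgradient[OF assms(1) that(1,2)] by linarith
  qed
  show "\<bar>?w (\<theta> * z)\<bar> \<le> max \<bar>?w (v_lo M)\<bar> \<bar>?w (v_hi M)\<bar>" if "z \<in> {z_lo M..z_hi M}" for z
  proof -
    have v: "\<theta> * z \<in> vals M" by (rule v_in_vals[OF assms(2) that])
    then have "?w (v_lo M) \<le> ?w (\<theta> * z)" "?w (\<theta> * z) \<le> ?w (v_hi M)"
      using v_lo_in_vals v_hi_in_vals by (auto intro!: mono simp: vals_def)
    then show ?thesis by linarith
  qed
qed (simp add: utility_def, measurable)

lemma slope_nonneg: "\<theta> \<in> signals M \<Longrightarrow> 0 \<le> slope q \<theta>"
  unfolding slope_def
proof (rule integral_nonneg_AE)
  show "AE z in shock_law M. 0 \<le> z * q \<theta> (\<theta> * z) powr alpha M"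
    using AE_shock by eventually_elim (use shocks in auto)
qed

lemma surplus_eq:
  assumes "\<theta> \<in> signals M"
  shows "surplus q \<theta> = \<theta> * slope q \<theta> - cost M * (LINT z|shock_law M. q \<theta> (\<theta> * z))"
  unfolding surplus_def slope_def
  using integrable_q[OF assms assms] integrable_q_powr[OF assms assms]
  by (simp add: mult.assoc)

text \<open>Couple the two types by a common shock z: the subgradient inequality at the values
  \<theta>' z and \<theta> z has increment (\<theta> - \<theta>') z, and averaging over z turns it
  into an inequality in the signal.\<close>

lemma gross_rent_subgradient:
  assumes "\<theta>' \<in> signals M" "\<theta> \<in> signals M"
  shows "rent q t \<theta>' + (\<theta> - \<theta>') * slope q \<theta>' \<le> gross_rent q t \<theta>' \<theta>"
proof -
  have "rent q t \<theta>' + (\<theta> - \<theta>') * slope q \<theta>' =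
      (LINT z|shock_law M. utility M (\<theta>' * z) (q \<theta>' (\<theta>' * z)) (t \<theta>' (\<theta>' * z))
        + (\<theta> - \<theta>') * (z * q \<theta>' (\<theta>' * z) powr alpha M))"
    using assms integrable_utility integrable_q_powr
    by (simp add: gross_rent_def slope_def)
  also have "\<dots> \<le> gross_rent q t \<theta>' \<theta>"
    unfolding gross_rent_def
  proof (rule integral_shock_mono)
    fix z assume z: "z \<in> {z_lo M<..<z_hi M}"
    then have "\<theta>' * z \<in> vals M" "\<theta> * z \<in> vals M"
      using v_in_vals assms by auto
    then show "utility M (\<theta>' * z) (q \<theta>' (\<theta>' * z)) (t \<theta>' (\<theta>' * z))
        + (\<theta> - \<theta>') * (z * q \<theta>' (\<theta>' * z) powr alpha M)
        \<le> utility M (\<theta> * z) (q \<theta>' (\<theta> * z)) (t \<theta>' (\<theta> * z))"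
      using utility_subgradient[OF assms(1), of "\<theta>' * z" "\<theta> * z"] by (simp add: algebra_simps)
  qed (use assms integrable_utility integrable_q_powr in auto)
  finally show ?thesis .
qed

section \<open>Consequences of incentive compatibility in the signal\<close>

context
  assumes ic0: "IC0 M q t"
begin

lemma rent_subgradient:
  assumes "\<theta>' \<in> signals M" "\<theta> \<in> signals M"
  shows "rent q t \<theta>' + (\<theta> - \<theta>') * slope q \<theta>' \<le> rent q t \<theta>"
  using gross_rent_subgradient[OF assms] ic0 assms
  by (fastforce simp: IC0_def gross_rent_eq)

lemma rent_eq_integral:
  assumes "x \<in> signals M" "y \<in> signals M" "x \<le> y"
  shows "rent q t y = rent q t x + (LINT u:{x..y}|lborel. slope q u)"
  using assms
  by (intro subgradient_integral measurable_slope rent_subgradient) (auto simp: signals_def)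

lemma slope_mono:
  assumes "x \<in> signals M" "y \<in> signals M" "x \<le> y"
  shows "slope q x \<le> slope q y"
proof (cases "x = y")
  case False
  have "(y - x) * slope q x \<le> (y - x) * slope q y"
    using rent_subgradient[OF assms(1,2)] rent_subgradient[OF assms(2,1)]
    by (simp add: algebra_simps)
  then show ?thesis using assms(3) False by simp
qed simp

lemma slope_bounded:
  assumes "\<theta> \<in> signals M"
  shows "\<bar>slope q \<theta>\<bar> \<le> slope q (th_hi M)"
  using slope_nonneg[OF assms] slope_mono[OF assms, of "th_hi M"] assms signals
  by (auto simp: signals_def)

lemma integrable_rent: "integrable (signal_law M) (rent q t)"
proof (rule integrable_signal_bounded)
  let ?B = "max \<bar>rent q t (th_lo M)\<bar> \<bar>rent q t (th_hi M)\<bar>"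
  show "\<bar>rent q t \<theta>\<bar> \<le> ?B" if \<theta>: "\<theta> \<in> signals M" for \<theta>
  proof -
    have s: "th_lo M \<in> signals M" "th_hi M \<in> signals M" using signals by (auto simp: signals_def)
    have "0 \<le> (\<theta> - th_lo M) * slope q (th_lo M)" "0 \<le> (th_hi M - \<theta>) * slope q \<theta>"
      using \<theta> slope_nonneg s by (auto simp: signals_def)
    then have "rent q t (th_lo M) \<le> rent q t \<theta>" "rent q t \<theta> \<le> rent q t (th_hi M)"
      using rent_subgradient[OF s(1) \<theta>] rent_subgradient[OF \<theta> s(2)] by linarith+
    then show ?thesis by linarith
  qed
qed measurable

text \<open>A mechanism guarantees integrability of the profit t - q c only. The inner integral of
  the profit is surplus minus rent, and the rent is monotone, hence bounded on the signals; so the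
  surplus is integrable as well and the two can be separated.\<close>

lemma payoff_eq_surplus_minus_rent:
  shows "integrable (signal_law M) (surplus q)"
    and "payoff M q t = (LINT \<theta>|signal_law M. surplus q \<theta>) - (LINT \<theta>|signal_law M. rent q t \<theta>)"
proof -
  note [measurable (raw)] = measurable_q measurable_t
  let ?P = "signal_law M \<Otimes>\<^sub>M shock_law M"
  let ?k = "\<lambda>(\<theta>, z). t \<theta> (\<theta> * z) - q \<theta> (\<theta> * z) * cost M"
  have T: "(\<lambda>(\<theta>, z). (\<theta>, \<theta> * z)) \<in> ?P \<rightarrow>\<^sub>M (borel :: (real \<times> real) measure)"
    unfolding case_prod_beta by (intro borel_measurable_Pair) measurable
  have g: "(\<lambda>(\<theta>, v). t \<theta> v - q \<theta> v * cost M) \<in> borel_measurable borel"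
    unfolding case_prod_beta borel_prod[symmetric] by measurable
  have int: "integrable ?P ?k"
    using mech integrable_distr_eq[OF T g]
    by (simp add: mechanism_def joint_law_def case_prod_unfold)
  have pay: "payoff M q t = (LINT p|?P. ?k p)"
    unfolding payoff_def joint_law_def integral_distr[OF T g] by (simp add: case_prod_beta)
  have eq: "(LINT z|shock_law M. ?k (\<theta>, z)) = surplus q \<theta> - rent q t \<theta>" if "\<theta> \<in> signals M" for \<theta>
  proof -
    have "surplus q \<theta> - rent q t \<theta> =
        (LINT z|shock_law M. (\<theta> * (z * q \<theta> (\<theta> * z) powr alpha M) - cost M * q \<theta> (\<theta> * z))
          - utility M (\<theta> * z) (q \<theta> (\<theta> * z)) (t \<theta> (\<theta> * z)))"
      unfolding surplus_def gross_rent_def mult.assoc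
      using integrable_q[OF that that] integrable_q_powr[OF that that] integrable_utility[OF that that]
      by (intro Bochner_Integration.integral_diff[symmetric]) auto
    also have "\<dots> = (LINT z|shock_law M. ?k (\<theta>, z))"
      by (intro Bochner_Integration.integral_cong) (auto simp: utility_def algebra_simps)
    finally show ?thesis by simp
  qed
  have AEeq: "AE \<theta> in signal_law M. (LINT z|shock_law M. ?k (\<theta>, z)) = surplus q \<theta> - rent q t \<theta>"
    using AE_signal by eventually_elim (auto intro!: eq[unfolded prod.case] simp: signals_def)
  have "integrable (signal_law M) (\<lambda>\<theta>. LINT z|shock_law M. ?k (\<theta>, z))"
    using pair.integrable_fst'[OF int] .
  then have sr: "integrable (signal_law M) (\<lambda>\<theta>. surplus q \<theta> - rent q t \<theta>)"
    by (rule integrable_cong_AE_imp[OF _ _ AEeq]) measurable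
  show "integrable (signal_law M) (surplus q)"
    using Bochner_Integration.integrable_add[OF sr integrable_rent] by simp
  have "payoff M q t = (LINT \<theta>|signal_law M. LINT z|shock_law M. ?k (\<theta>, z))"
    unfolding pay by (rule pair.integral_fst'[OF int, symmetric])
  also have "\<dots> = (LINT \<theta>|signal_law M. surplus q \<theta> - rent q t \<theta>)"
    using AEeq borel_measurable_integrable[OF sr]
      borel_measurable_integrable[OF pair.integrable_fst'[OF int]]
    by (intro integral_cong_AE)
  also have "\<dots> = (LINT \<theta>|signal_law M. surplus q \<theta>) - (LINT \<theta>|signal_law M. rent q t \<theta>)"
    using \<open>integrable (signal_law M) (surplus q)\<close> integrable_rent
    by (rule Bochner_Integration.integral_diff)
  finally show "payoff M q t = \<dots>" .
qed

end

end

end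

end

section \<open>Allocations that are powers of the value\<close>

context screening_model
begin

text \<open>The quantity maximizing a multiple of v q^\<alpha> minus a linear cost is proportional
  to v to the power \<open>gam\<close>; its power \<alpha> is proportional to v to the power
  \<open>bet\<close>.\<close>

abbreviation "gam \<equiv> 1 / (1 - alpha M)"
abbreviation "bet \<equiv> alpha M / (1 - alpha M)"

lemma gam_pos: "0 < gam" and bet_pos: "0 < bet"
  using alpha by auto

lemma gam_eq: "gam = bet + 1"
  using alpha by (simp add: field_simps)

lemma powr_gam: "0 \<le> x \<Longrightarrow> x powr gam = x * x powr bet"
  unfolding gam_eq by (simp add: powr_add)

definition moment :: real where
  "moment = (LINT z|shock_law M. z powr gam)"

text \<open>The coefficient of the spot purchase: a spot buyer with value v chooses q with
  q^\<alpha> equal to \<open>spot_scale * v powr bet\<close>.\<close>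

definition spot_scale :: real where
  "spot_scale = (alpha M / spot_price M) powr bet"

lemma integrable_shock_powr: "integrable (shock_law M) (\<lambda>z. z powr gam)"
  by (rule integrable_shock_bounded[where B = "z_hi M powr gam"])
    (use shocks gam_pos in \<open>auto intro!: powr_mono2\<close>)

lemma moment_pos: "0 < moment"
proof -
  have "0 \<le> moment"
    unfolding moment_def by (rule integral_nonneg_AE) simp
  moreover have "moment \<noteq> 0"
  proof
    assume "moment = 0"
    then have "AE z in shock_law M. z powr gam = 0"
      unfolding moment_def
      by (subst (asm) integral_nonneg_eq_0_iff_AE) (use integrable_shock_powr in auto)
    with AE_shock have "AE z in shock_law M. False"
      by eventually_elim (use shocks in auto)
    then show False by simp
  qed
  ultimately show ?thesis by simp
qed

lemma spot_scale_pos: "0 < spot_scale"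
  using alpha cost spot_price by (simp add: spot_scale_def)

lemma signals_nonneg: "\<theta> \<in> signals M \<Longrightarrow> 0 \<le> \<theta>"
  using signals by (simp add: signals_def)

lemma th_lo_in: "th_lo M \<in> signals M" and th_hi_in: "th_hi M \<in> signals M"
  using signals by (auto simp: signals_def)

lemma integral_shock_powr:
  "0 \<le> \<theta> \<Longrightarrow> (LINT z|shock_law M. k * (\<theta> * z) powr gam) = k * (moment * \<theta> powr gam)"
  using integrable_shock_powr by (simp add: powr_mult moment_def mult_ac)

lemma spot_utility_eq:
  assumes "\<theta> \<in> signals M"
  shows "spot_utility M \<theta> = moment * spot_scale * \<theta> powr gam / gam"
proof -
  have p: "0 < spot_price M" using cost spot_price by simp
  \<comment> \<open>The supremum is evaluated for every real v, to integrate it as a function on the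
    line; for negative v the best quantity is 0, hence the positive part.\<close>
  have sup: "(SUP q\<in>{0..}. v * q powr alpha M - spot_price M * q) =
      (1 - alpha M) * spot_scale * (max v 0) powr gam" for v
  proof (rule cSup_eq_maximum)
    let ?q = "(alpha M * max v 0 / spot_price M) powr gam"
    have "v * ?q powr alpha M - spot_price M * ?q = (1 - alpha M) * spot_scale * (max v 0) powr gam"
      using powr_surplus_max[OF alpha p, of "max v 0"] by (cases "0 \<le> v") (auto simp: spot_scale_def max_def)
    then show "(1 - alpha M) * spot_scale * (max v 0) powr gam
        \<in> (\<lambda>q. v * q powr alpha M - spot_price M * q) ` {0..}"
      by (intro image_eqI[of _ _ ?q]) auto
    show "y \<le> (1 - alpha M) * spot_scale * (max v 0) powr gam"
      if y: "y \<in> (\<lambda>q. v * q powr alpha M - spot_price M * q) ` {0..}" for y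
    proof -
      obtain q where q: "0 \<le> q" "y = v * q powr alpha M - spot_price M * q" using y by auto
      have "y \<le> max v 0 * q powr alpha M - spot_price M * q"
        using q by (simp add: mult_right_mono)
      also have "\<dots> \<le> (1 - alpha M) * spot_scale * (max v 0) powr gam"
        using powr_surplus_le(1)[OF alpha p _ q(1), of "max v 0"] powr_surplus_max[OF alpha p, of "max v 0"]
        by (simp add: spot_scale_def)
      finally show ?thesis .
    qed
  qed
  have "spot_utility M \<theta> = (LINT z|shock_law M. (1 - alpha M) * spot_scale * (max (\<theta> * z) 0) powr gam)"
    unfolding spot_utility_def sup by (rule integral_value_law) measurable
  also have "\<dots> = (LINT z|shock_law M. (1 - alpha M) * spot_scale * (\<theta> * z) powr gam)"
  proof (rule integral_shock_cong)
    fix z assume "z \<in> {z_lo M<..<z_hi M}"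
    then have "0 \<le> \<theta> * z"
      using signals_nonneg[OF assms] shocks by (intro mult_nonneg_nonneg) auto
    then show "(1 - alpha M) * spot_scale * (max (\<theta> * z) 0) powr gam =
        (1 - alpha M) * spot_scale * (\<theta> * z) powr gam"
      by (simp add: max_def)
  qed measurable
  finally show ?thesis
    unfolding integral_shock_powr[OF signals_nonneg[OF assms]] by (simp add: mult_ac)
qed

text \<open>
  The mechanism with \<open>q powr \<alpha> = A \<theta> * v powr bet\<close>. Its rent integrates the envelope formula starting from the
  spot utility of the lowest signal, and the last term of the price is the rent from the realized
  value, normalized to have mean 0.
\<close>

definition scaled_q :: "(real \<Rightarrow> real) \<Rightarrow> real \<Rightarrow> real \<Rightarrow> real" where
  "scaled_q A \<theta> v = A \<theta> powr (1 / alpha M) * v powr gam"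

definition scaled_rent :: "(real \<Rightarrow> real) \<Rightarrow> real \<Rightarrow> real" where
  "scaled_rent A \<theta> = moment * (spot_scale * th_lo M powr gam / gam
     + (LINT u:{th_lo M..\<theta>}|lborel. A u * u powr bet))"

definition scaled_t :: "(real \<Rightarrow> real) \<Rightarrow> real \<Rightarrow> real \<Rightarrow> real" where
  "scaled_t A \<theta> v = v * scaled_q A \<theta> v powr alpha M
     - (scaled_rent A \<theta> + A \<theta> / gam * (v powr gam - moment * \<theta> powr gam))"

section \<open>Feasibility of power allocations\<close>

context
  fixes A :: "real \<Rightarrow> real"
  assumes A_meas [measurable]: "A \<in> borel_measurable borel"
    and A_mono: "\<And>x y. x \<in> signals M \<Longrightarrow> y \<in> signals M \<Longrightarrow> x \<le> y \<Longrightarrow> A x \<le> A y"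
    and A_ge: "\<And>x. x \<in> signals M \<Longrightarrow> spot_scale \<le> A x"
begin

lemma A_pos: "x \<in> signals M \<Longrightarrow> 0 < A x"
  using A_ge[of x] spot_scale_pos by simp

lemma A_le: "x \<in> signals M \<Longrightarrow> A x \<le> A (th_hi M)"
  using A_mono[OF _ th_hi_in] by (simp add: signals_def)

lemma scaled_q_powr:
  assumes "\<theta> \<in> signals M" "0 \<le> v"
  shows "scaled_q A \<theta> v powr alpha M = A \<theta> * v powr bet"
  using A_pos[OF assms(1)] assms(2) alpha by (simp add: scaled_q_def powr_mult powr_powr)

lemma scaled_slope_integrable:
  assumes "x \<in> signals M" "y \<in> signals M"
  shows "set_integrable lborel {x..y} (\<lambda>u. A u * u powr bet)"
proof (rule set_integrable_bounded_on)
  show "\<bar>A u * u powr bet\<bar> \<le> A (th_hi M) * th_hi M powr bet" if "u \<in> {th_lo M..th_hi M}" for u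
    using that A_pos[of u] A_le[of u] signals bet_pos
    by (auto simp: abs_mult signals_def intro!: mult_mono powr_mono2)
qed (use assms in \<open>auto simp: signals_def\<close>)

lemma scaled_rent_diff:
  assumes "x \<in> signals M" "y \<in> signals M" "x \<le> y"
  shows "scaled_rent A y = scaled_rent A x + moment * (LINT u:{x..y}|lborel. A u * u powr bet)"
proof -
  have "(LINT u:{th_lo M..y}|lborel. A u * u powr bet) =
      (LINT u:{th_lo M..x}|lborel. A u * u powr bet) + (LINT u:{x..y}|lborel. A u * u powr bet)"
    using assms scaled_slope_integrable[OF th_lo_in assms(2)]
    by (intro set_integral_Icc_combine) (auto simp: signals_def)
  then show ?thesis by (simp add: scaled_rent_def algebra_simps)
qed

lemma powr_set_integrable:
  assumes "x \<in> signals M" "y \<in> signals M"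
  shows "set_integrable lborel {x..y} (\<lambda>u. k * u powr bet)"
proof (rule set_integrable_bounded_on)
  show "\<bar>k * u powr bet\<bar> \<le> \<bar>k\<bar> * th_hi M powr bet" if "u \<in> {th_lo M..th_hi M}" for u
    using that signals bet_pos by (auto simp: abs_mult intro!: mult_mono powr_mono2)
qed (use assms in \<open>auto simp: signals_def\<close>)

lemma scaled_powr_integral:
  assumes "x \<in> signals M" "y \<in> signals M" "x \<le> y"
  shows "(LINT u:{x..y}|lborel. k * u powr bet) = k * (y powr gam - x powr gam) / gam"
  using powr_integral[of bet x y] bet_pos signals_nonneg[OF assms(1)] assms(3)
  unfolding gam_eq[symmetric] by simp

text \<open>Replacing A by its value at either end of [x, y] bounds the envelope integral from both
  sides. In view of \<open>scaled_gross_rent\<close>, the first bound says that y does not gain by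
  reporting x, the second that x does not gain by reporting y.\<close>

lemma scaled_rent_mono_bounds:
  assumes "x \<in> signals M" "y \<in> signals M" "x \<le> y"
  shows "moment * A x * (y powr gam - x powr gam) / gam \<le> scaled_rent A y - scaled_rent A x"
    and "scaled_rent A y - scaled_rent A x \<le> moment * A y * (y powr gam - x powr gam) / gam"
proof -
  have u: "u \<in> signals M" if "u \<in> {x..y}" for u using that assms by (auto simp: signals_def)
  have "(LINT u:{x..y}|lborel. A x * u powr bet) \<le> (LINT u:{x..y}|lborel. A u * u powr bet)"
    using assms u by (intro set_integral_mono powr_set_integrable scaled_slope_integrable)
      (auto intro!: mult_right_mono A_mono)
  moreover have "(LINT u:{x..y}|lborel. A u * u powr bet) \<le> (LINT u:{x..y}|lborel. A y * u powr bet)"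
    using assms u by (intro set_integral_mono powr_set_integrable scaled_slope_integrable)
      (auto intro!: mult_right_mono A_mono)
  ultimately have
    "moment * (A x * (y powr gam - x powr gam) / gam) \<le> moment * (LINT u:{x..y}|lborel. A u * u powr bet)"
    "moment * (LINT u:{x..y}|lborel. A u * u powr bet) \<le> moment * (A y * (y powr gam - x powr gam) / gam)"
    unfolding scaled_powr_integral[OF assms] using moment_pos by (auto intro!: mult_left_mono)
  then show "moment * A x * (y powr gam - x powr gam) / gam \<le> scaled_rent A y - scaled_rent A x"
    "scaled_rent A y - scaled_rent A x \<le> moment * A y * (y powr gam - x powr gam) / gam"
    unfolding scaled_rent_diff[OF assms] by (simp_all add: mult.assoc)
qed

lemma scaled_rent_th_lo: "scaled_rent A (th_lo M) = moment * spot_scale * th_lo M powr gam / gam"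
  using set_integral_at_point[of lborel "th_lo M" "\<lambda>u. A u * u powr bet"]
    scaled_slope_integrable[OF th_lo_in th_lo_in]
  by (simp add: scaled_rent_def)

text \<open>The rent starts at the spot utility of the lowest signal and its slope is never below
  that of the spot utility, because A is at least \<open>spot_scale\<close>.\<close>

lemma scaled_rent_ge_spot:
  assumes "\<theta> \<in> signals M"
  shows "spot_utility M \<theta> \<le> scaled_rent A \<theta>"
proof -
  have le: "th_lo M \<le> \<theta>" using assms by (simp add: signals_def)
  have "0 \<le> \<theta> powr gam - th_lo M powr gam"
    using le signals gam_pos by (simp add: powr_mono2)
  then have "moment * spot_scale * (\<theta> powr gam - th_lo M powr gam) / gam
      \<le> moment * A (th_lo M) * (\<theta> powr gam - th_lo M powr gam) / gam"
    using A_ge[OF th_lo_in] moment_pos gam_pos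
    by (intro divide_right_mono mult_right_mono mult_left_mono) auto
  also have "\<dots> \<le> scaled_rent A \<theta> - scaled_rent A (th_lo M)"
    by (rule scaled_rent_mono_bounds(1)[OF th_lo_in assms le])
  finally show ?thesis
    unfolding spot_utility_eq[OF assms] scaled_rent_th_lo
    by (simp only: right_diff_distrib diff_divide_distrib)
qed

text \<open>Between the lower bound \<open>spot_scale\<close> and monotonicity, A is equal to
  \<open>spot_scale\<close> at all smaller signals too, so the rent has followed the spot utility up
  to \<theta>.\<close>

lemma scaled_rent_eq_spot:
  assumes "\<theta> \<in> signals M" "A \<theta> = spot_scale"
  shows "scaled_rent A \<theta> = spot_utility M \<theta>"
proof (rule antisym)
  have "scaled_rent A \<theta> - scaled_rent A (th_lo M) \<le>
      moment * spot_scale * (\<theta> powr gam - th_lo M powr gam) / gam"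
    using scaled_rent_mono_bounds(2)[OF th_lo_in assms(1)] assms by (simp add: signals_def)
  then show "scaled_rent A \<theta> \<le> spot_utility M \<theta>"
    unfolding spot_utility_eq[OF assms(1)] scaled_rent_th_lo
    by (simp only: right_diff_distrib diff_divide_distrib)
qed (rule scaled_rent_ge_spot[OF assms(1)])

lemma scaled_rent_measurable [measurable]: "scaled_rent A \<in> borel_measurable borel"
proof -
  have "(\<lambda>\<theta>. LINT u|lborel. indicat_real {th_lo M..\<theta>} u *\<^sub>R (A u * u powr bet)) \<in> borel_measurable borel"
    by (rule lborel.borel_measurable_lebesgue_integral) (simp add: indicator_def case_prod_beta, measurable)
  then show ?thesis
    unfolding scaled_rent_def set_lebesgue_integral_def by measurable
qed

lemma scaled_utility:
  assumes "\<theta> \<in> signals M" "0 \<le> v"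
  shows "utility M v (scaled_q A \<theta> v) (scaled_t A \<theta> v) =
    scaled_rent A \<theta> + A \<theta> / gam * (v powr gam - moment * \<theta> powr gam)"
  by (simp add: utility_def scaled_t_def)

lemma scaled_mechanism: "mechanism M (scaled_q A) (scaled_t A)"
proof -
  have q [measurable]: "(\<lambda>(\<theta>, v). scaled_q A \<theta> v) \<in> borel_measurable borel"
    unfolding scaled_q_def case_prod_beta borel_prod[symmetric] by measurable
  have t [measurable]: "(\<lambda>(\<theta>, v). scaled_t A \<theta> v) \<in> borel_measurable borel"
    unfolding scaled_t_def scaled_q_def case_prod_beta borel_prod[symmetric] by measurable
  let ?P = "signal_law M \<Otimes>\<^sub>M shock_law M"
  let ?k = "\<lambda>(\<theta>, v). scaled_t A \<theta> v - scaled_q A \<theta> v * cost M"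
  have k: "?k \<in> borel_measurable borel"
    unfolding scaled_t_def scaled_q_def case_prod_beta borel_prod[symmetric] by measurable
  have T: "(\<lambda>(\<theta>, z). (\<theta>, \<theta> * z)) \<in> ?P \<rightarrow>\<^sub>M (borel :: (real \<times> real) measure)"
    unfolding case_prod_beta by (intro borel_measurable_Pair) measurable
  define V where "V = v_hi M powr gam"
  define R where "R = max \<bar>scaled_rent A (th_lo M)\<bar> \<bar>scaled_rent A (th_hi M)\<bar>"
  \<comment> \<open>One summand for each term of the profit: gross value, mean rent, rent from the
    realized value, and cost. Integrability is then boundedness on a probability space.\<close>
  define B where "B = A (th_hi M) * V + R + A (th_hi M) / gam * (V + moment * th_hi M powr gam)
    + A (th_hi M) powr (1 / alpha M) * V * cost M"
  have bound: "\<bar>?k (\<theta>, v)\<bar> \<le> B" if \<theta>: "\<theta> \<in> signals M" and v: "v \<in> vals M" for \<theta> v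
  proof -
    have v0: "0 \<le> v" using vals_nonneg[OF v] .
    have V: "0 \<le> v powr gam" "v powr gam \<le> V"
      using v0 v gam_pos by (auto simp: V_def vals_def intro: powr_mono2)
    have A: "0 < A \<theta>" "A \<theta> \<le> A (th_hi M)" using A_pos[OF \<theta>] A_le[OF \<theta>] by auto
    have th: "th_lo M \<le> \<theta>" "\<theta> \<le> th_hi M" "0 \<le> \<theta>"
      using \<theta> signals_nonneg by (auto simp: signals_def)
    have "0 \<le> \<theta> powr gam - th_lo M powr gam" "0 \<le> th_hi M powr gam - \<theta> powr gam"
      using th signals gam_pos by (simp_all add: powr_mono2)
    then have "scaled_rent A (th_lo M) \<le> scaled_rent A \<theta>" "scaled_rent A \<theta> \<le> scaled_rent A (th_hi M)"
      using scaled_rent_mono_bounds(1)[OF th_lo_in \<theta> th(1)] scaled_rent_mono_bounds(1)[OF \<theta> th_hi_in th(2)]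
        A_pos[OF th_lo_in] A moment_pos gam_pos
      by (smt (verit) mult_nonneg_nonneg divide_nonneg_pos)+
    then have R: "\<bar>scaled_rent A \<theta>\<bar> \<le> R" unfolding R_def by linarith
    have 1: "\<bar>A \<theta> * v powr gam\<bar> \<le> A (th_hi M) * V"
      using A V by (auto simp: abs_mult intro!: mult_mono)
    have "\<bar>v powr gam - moment * \<theta> powr gam\<bar> \<le> V + moment * th_hi M powr gam"
    proof -
      have "moment * \<theta> powr gam \<le> moment * th_hi M powr gam" "0 \<le> moment * \<theta> powr gam"
        using moment_pos th gam_pos by (auto intro!: powr_mono2)
      then show ?thesis using V by linarith
    qed
    then have 2: "\<bar>A \<theta> / gam * (v powr gam - moment * \<theta> powr gam)\<bar>
        \<le> A (th_hi M) / gam * (V + moment * th_hi M powr gam)"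
      unfolding abs_mult using A gam_pos by (intro mult_mono divide_right_mono) auto
    have 3: "\<bar>scaled_q A \<theta> v * cost M\<bar> \<le> A (th_hi M) powr (1 / alpha M) * V * cost M"
      unfolding scaled_q_def abs_mult using A V alpha cost
      by (intro mult_mono) (auto intro!: powr_mono2 mult_nonneg_nonneg intro: order_trans[OF V])
    have "?k (\<theta>, v) = A \<theta> * v powr gam
        - (scaled_rent A \<theta> + A \<theta> / gam * (v powr gam - moment * \<theta> powr gam)) - scaled_q A \<theta> v * cost M"
      using powr_gam[OF v0] by (simp add: scaled_t_def scaled_q_powr[OF \<theta> v0])
    then show ?thesis using 1 2 3 R unfolding B_def by linarith
  qed
  have "integrable ?P (\<lambda>p. ?k (case p of (\<theta>, z) \<Rightarrow> (\<theta>, \<theta> * z)))"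
  proof (rule pair.P.integrable_const_bound[where B = B])
    have meas: "(\<lambda>p. ?k (case p of (\<theta>, z) \<Rightarrow> (\<theta>, \<theta> * z))) \<in> borel_measurable ?P"
      by (rule measurable_compose[OF T k])
    then show "(\<lambda>p. ?k (case p of (\<theta>, z) \<Rightarrow> (\<theta>, \<theta> * z))) \<in> borel_measurable ?P" .
    show "AE p in ?P. norm (?k (case p of (\<theta>, z) \<Rightarrow> (\<theta>, \<theta> * z))) \<le> B"
    proof (rule pair.AE_pair_measure)
      show "{p \<in> space ?P. norm (?k (case p of (\<theta>, z) \<Rightarrow> (\<theta>, \<theta> * z))) \<le> B} \<in> sets ?P"
        using meas by measurable
      show "AE \<theta> in signal_law M. AE z in shock_law M. norm (?k (case (\<theta>, z) of (\<theta>, z) \<Rightarrow> (\<theta>, \<theta> * z))) \<le> B"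
        using AE_signal
      proof eventually_elim
        case (elim \<theta>)
        then have \<theta>: "\<theta> \<in> signals M" by (auto simp: signals_def)
        show ?case
          using AE_shock
        proof eventually_elim
          case (elim z)
          then have "\<theta> * z \<in> vals M" by (intro v_in_vals \<theta>) auto
          from bound[OF \<theta> this] show ?case by simp
        qed
      qed
    qed
  qed
  then have "integrable (joint_law M) ?k"
    unfolding joint_law_def integrable_distr_eq[OF T k] .
  then show ?thesis
    unfolding mechanism_def using q t by (simp add: scaled_q_def)
qed

text \<open>Under the report \<theta>' utility depends on v only through A \<theta>' v^gam / gam, so
  the misreporting type changes just the mean of that term, from
  \<open>moment * \<theta>' powr gam\<close> to \<open>moment * \<theta> powr gam\<close>.\<close>

lemma scaled_gross_rent:
  assumes "\<theta>' \<in> signals M" "\<theta> \<in> signals M"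
  shows "gross_rent (scaled_q A) (scaled_t A) \<theta>' \<theta> =
    scaled_rent A \<theta>' + moment * A \<theta>' * (\<theta> powr gam - \<theta>' powr gam) / gam"
proof -
  have "gross_rent (scaled_q A) (scaled_t A) \<theta>' \<theta> =
      (LINT z|shock_law M. (scaled_rent A \<theta>' - A \<theta>' / gam * (moment * \<theta>' powr gam))
         + A \<theta>' / gam * (\<theta> * z) powr gam)"
    unfolding gross_rent_def
  proof (rule integral_shock_cong)
    show "(\<lambda>z. utility M (\<theta> * z) (scaled_q A \<theta>' (\<theta> * z)) (scaled_t A \<theta>' (\<theta> * z))) \<in> borel_measurable borel"
      unfolding utility_def scaled_t_def scaled_q_def by measurable
    fix z assume "z \<in> {z_lo M<..<z_hi M}"
    then have "0 \<le> \<theta> * z" using signals_nonneg[OF assms(2)] shocks by auto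
    from scaled_utility[OF assms(1) this]
    show "utility M (\<theta> * z) (scaled_q A \<theta>' (\<theta> * z)) (scaled_t A \<theta>' (\<theta> * z)) =
        (scaled_rent A \<theta>' - A \<theta>' / gam * (moment * \<theta>' powr gam)) + A \<theta>' / gam * (\<theta> * z) powr gam"
      by (simp only: right_diff_distrib)
  qed measurable
  also have "\<dots> = (scaled_rent A \<theta>' - A \<theta>' / gam * (moment * \<theta>' powr gam))
      + A \<theta>' / gam * (moment * \<theta> powr gam)"
  proof -
    have "integrable (shock_law M) (\<lambda>z. A \<theta>' / gam * (\<theta> * z) powr gam)"
      using integrable_shock_powr signals_nonneg[OF assms(2)] by (simp add: powr_mult)
    moreover have "shock.prob UNIV = 1" using shock.prob_space by simp
    ultimately show ?thesis
      unfolding integral_shock_powr[OF signals_nonneg[OF assms(2)], of "A \<theta>' / gam", symmetric]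
      by (subst Bochner_Integration.integral_add) simp_all
  qed
  finally show ?thesis by (simp add: algebra_simps diff_divide_distrib)
qed

lemma scaled_feasible: "feasible M (scaled_q A) (scaled_t A)"
  unfolding feasible_def
proof (intro conjI)
  show mech: "mechanism M (scaled_q A) (scaled_t A)" by (rule scaled_mechanism)
  show "IC1 M (scaled_q A) (scaled_t A)"
    unfolding IC1_def
  proof (intro ballI)
    fix \<theta> v v' assume \<theta>: "\<theta> \<in> signals M" and v: "v \<in> vals M" and v': "v' \<in> vals M"
    note v0 = vals_nonneg[OF v] vals_nonneg[OF v']
    have "utility M v (scaled_q A \<theta> v') (scaled_t A \<theta> v') =
        (v - v') * (A \<theta> * v' powr bet) + utility M v' (scaled_q A \<theta> v') (scaled_t A \<theta> v')"
      using scaled_q_powr[OF \<theta> v0(2)] by (simp add: utility_def algebra_simps)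
    \<comment> \<open>For a fixed signal, incentive compatibility in the value is the convexity of
      v^gam.\<close>
    also have "(v - v') * (A \<theta> * v' powr bet) \<le> A \<theta> / gam * (v powr gam - v' powr gam)"
      using mult_left_mono[OF powr_gradient_le[OF alpha v0(2,1)] less_imp_le[OF A_pos[OF \<theta>]]]
      by (simp add: mult_ac)
    finally show "utility M v (scaled_q A \<theta> v') (scaled_t A \<theta> v')
        \<le> utility M v (scaled_q A \<theta> v) (scaled_t A \<theta> v)"
      unfolding scaled_utility[OF \<theta> v0(1)] scaled_utility[OF \<theta> v0(2)]
      by (simp only: right_diff_distrib) linarith
  qed
  show "IC0 M (scaled_q A) (scaled_t A)"
    unfolding IC0_def gross_rent_eq[OF mech]
  proof (intro ballI)
    fix \<theta> \<theta>' assume \<theta>: "\<theta> \<in> signals M" and \<theta>': "\<theta>' \<in> signals M"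
    show "gross_rent (scaled_q A) (scaled_t A) \<theta>' \<theta> \<le> rent (scaled_q A) (scaled_t A) \<theta>"
    proof (cases "\<theta>' \<le> \<theta>")
      case True
      then show ?thesis
        using scaled_rent_mono_bounds(1)[OF \<theta>' \<theta>]
        by (simp add: scaled_gross_rent[OF \<theta>' \<theta>] scaled_gross_rent[OF \<theta> \<theta>])
    next
      case False
      have e: "moment * A \<theta>' * (\<theta> powr gam - \<theta>' powr gam) / gam =
          - (moment * A \<theta>' * (\<theta>' powr gam - \<theta> powr gam) / gam)"
        by (simp only: right_diff_distrib diff_divide_distrib)
      show ?thesis
        using scaled_rent_mono_bounds(2)[OF \<theta> \<theta>'] False
        unfolding scaled_gross_rent[OF \<theta>' \<theta>] scaled_gross_rent[OF \<theta> \<theta>] e by simp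
    qed
  qed
  show "spot_participation M (scaled_q A) (scaled_t A)"
    unfolding spot_participation_def gross_rent_eq[OF mech]
    using scaled_rent_ge_spot by (auto simp: scaled_gross_rent)
qed

lemma scaled_rent_eq: "\<theta> \<in> signals M \<Longrightarrow> rent (scaled_q A) (scaled_t A) \<theta> = scaled_rent A \<theta>"
  by (simp add: scaled_gross_rent)

lemma scaled_slope:
  assumes "\<theta> \<in> signals M"
  shows "slope (scaled_q A) \<theta> = moment * A \<theta> * \<theta> powr bet"
proof -
  have "slope (scaled_q A) \<theta> = (LINT z|shock_law M. A \<theta> * \<theta> powr bet * z powr gam)"
    unfolding slope_def
  proof (rule integral_shock_cong)
    show "(\<lambda>z. z * scaled_q A \<theta> (\<theta> * z) powr alpha M) \<in> borel_measurable borel"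
      unfolding scaled_q_def by measurable
    fix z assume "z \<in> {z_lo M<..<z_hi M}"
    then have z: "0 \<le> z" "0 \<le> \<theta> * z" using signals_nonneg[OF assms] shocks by auto
    show "z * scaled_q A \<theta> (\<theta> * z) powr alpha M = A \<theta> * \<theta> powr bet * z powr gam"
      unfolding scaled_q_powr[OF assms z(2)] powr_gam[OF z(1)] by (simp add: powr_mult)
  qed measurable
  then show ?thesis by (simp add: moment_def)
qed

end

lemma spot_price_pos: "0 < spot_price M"
  using cost spot_price by simp

text \<open>
  At zero cost, an arbitrarily large bonus quantity sold to the upper half of the signals yields
  arbitrarily high profit.
\<close>

lemma no_optimum_if_costless:
  assumes c: "cost M = 0"
  shows "\<not> optimal M q t"
proof
  assume "optimal M q t"
  \<comment> \<open>The midpoint is positive even when the lowest signal is 0, which makes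
    \<open>K\<close> below positive.\<close>
  define \<theta>1 where "\<theta>1 = (th_lo M + th_hi M) / 2"
  have \<theta>1: "\<theta>1 \<in> signals M" "\<theta>1 < th_hi M" "0 < \<theta>1" "\<theta>1 \<le> th_hi M"
    using signals by (auto simp: signals_def \<theta>1_def)
  define \<pi> where "\<pi> = signal.prob {\<theta>1..}"
  have \<pi>: "0 < \<pi>" using sig_cdf_less_1[OF \<theta>1(2)] sig_cdf_compl[of \<theta>1] by (simp add: \<pi>_def)
  define K where "K = moment * \<theta>1 powr gam / gam"
  have K: "0 < K" using moment_pos \<theta>1 gam_pos by (simp add: K_def)
  \<comment> \<open>Raising the coefficient to N above \<open>\<theta>1\<close> earns at least (N -
    \<open>spot_scale\<close>) K from each upper signal, and a nonnegative amount from the others;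
    this N exceeds the presumed optimal payoff by 1.\<close>
  define N where "N = spot_scale + (\<bar>payoff M q t\<bar> + 1) / (K * \<pi>)"
  have N: "spot_scale \<le> N" using K \<pi> by (simp add: N_def)
  define A where "A \<theta> = (if \<theta> \<le> \<theta>1 then spot_scale else N)" for \<theta>
  have A_below: "A \<theta> = spot_scale" if "\<theta> \<le> \<theta>1" for \<theta> using that by (simp add: A_def)
  have A_above: "A \<theta> = N" if "\<theta>1 < \<theta>" for \<theta> using that by (simp add: A_def)
  have A: "A \<in> borel_measurable borel" unfolding A_def by measurable
  have A_mono: "A x \<le> A y" if "x \<le> y" for x y using N that by (auto simp: A_def)
  have A_ge: "spot_scale \<le> A x" for x using N by (auto simp: A_def)
  note A' = A A_mono A_ge
  let ?q = "scaled_q A" and ?t = "scaled_t A"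
  have feas: "feasible M ?q ?t" using A' by (rule scaled_feasible)
  then have m: "mechanism M ?q ?t" "IC1 M ?q ?t" "IC0 M ?q ?t" by (auto simp: feasible_def)
  have gam1: "1 - 1 / gam = alpha M" using alpha by simp
  have bound: "indicat_real {\<theta>1<..} \<theta> * ((N - spot_scale) * K) \<le> surplus ?q \<theta> - rent ?q ?t \<theta>"
    if \<theta>: "\<theta> \<in> signals M" for \<theta>
  proof -
    have s: "surplus ?q \<theta> = moment * A \<theta> * \<theta> powr gam"
      using surplus_eq[OF m(1,2) \<theta>] scaled_slope[OF A' \<theta>] powr_gam[OF signals_nonneg[OF \<theta>]] c by simp
    have r: "rent ?q ?t \<theta> = scaled_rent A \<theta>" by (rule scaled_rent_eq[OF A' \<theta>])
    show ?thesis
    proof (cases "\<theta> \<le> \<theta>1")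
      case True
      then have "scaled_rent A \<theta> = moment * spot_scale * \<theta> powr gam / gam"
        using scaled_rent_eq_spot[OF A' \<theta>] spot_utility_eq[OF \<theta>] A_below[OF True] by simp
      then have "surplus ?q \<theta> - rent ?q ?t \<theta> = moment * spot_scale * \<theta> powr gam * (1 - 1 / gam)"
        using True by (simp add: s r A_def algebra_simps)
      also have "0 \<le> \<dots>" unfolding gam1 using moment_pos spot_scale_pos alpha by simp
      finally show ?thesis using True by simp
    next
      case False
      have "scaled_rent A \<theta>1 = spot_scale * K"
        using scaled_rent_eq_spot[OF A' \<theta>1(1)] spot_utility_eq[OF \<theta>1(1)] A_below[of \<theta>1]
        by (simp add: K_def)
      moreover have "scaled_rent A \<theta> - scaled_rent A \<theta>1 \<le>
          moment * N * (\<theta> powr gam - \<theta>1 powr gam) / gam"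
        using scaled_rent_mono_bounds(2)[OF A' \<theta>1(1) \<theta>] False A_above[of \<theta>] by simp
      moreover have "moment * N * (\<theta> powr gam - \<theta>1 powr gam) / gam =
          moment * N * \<theta> powr gam - moment * N * \<theta> powr gam * (1 - 1 / gam) - N * K"
        by (simp add: K_def algebra_simps diff_divide_distrib)
      moreover have "0 \<le> moment * N * \<theta> powr gam * (1 - 1 / gam)"
        unfolding gam1 using moment_pos spot_scale_pos N alpha by simp
      ultimately show ?thesis
        using False by (simp add: s r A_def algebra_simps)
    qed
  qed
  note p = payoff_eq_surplus_minus_rent[OF m]
  have "(N - spot_scale) * K * \<pi> = (LINT \<theta>|signal_law M. indicat_real {\<theta>1..} \<theta> * ((N - spot_scale) * K))"
    by (simp add: \<pi>_def mult_ac)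
  also have "\<dots> \<le> (LINT \<theta>|signal_law M. surplus ?q \<theta> - rent ?q ?t \<theta>)"
  proof (rule integral_mono_AE)
    show "AE \<theta> in signal_law M. indicat_real {\<theta>1..} \<theta> * ((N - spot_scale) * K) \<le> surplus ?q \<theta> - rent ?q ?t \<theta>"
      using AE_signal AE_lborel_singleton[of \<theta>1] unfolding AE_signal_law_iff
    proof eventually_elim
      case (elim \<theta>)
      then show ?case using bound[of \<theta>] by (auto simp: signals_def indicator_def split: if_splits)
    qed
    show "integrable (signal_law M) (\<lambda>\<theta>. indicat_real {\<theta>1..} \<theta> * ((N - spot_scale) * K))"
      by (rule integrable_signal_bounded[where B = "\<bar>(N - spot_scale) * K\<bar>"])
        (auto simp: indicator_def)
  qed (use p(1) integrable_rent[OF m] in auto)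
  also have "\<dots> = payoff M ?q ?t"
    unfolding p(2) using p(1) integrable_rent[OF m] by simp
  also have "\<dots> \<le> payoff M q t"
    using \<open>optimal M q t\<close> feas by (auto simp: optimal_def)
  finally have "(N - spot_scale) * K * \<pi> \<le> payoff M q t" .
  moreover have "(N - spot_scale) * K * \<pi> = \<bar>payoff M q t\<bar> + 1"
    using K \<pi> by (simp add: N_def)
  ultimately show False by linarith
qed

lemma compensation_nonneg_if_costless:
  assumes "cost M = 0" "\<theta> \<in> signals M"
  shows "0 \<le> spot_utility M \<theta> - u_star_exp M \<theta>"
proof -
  \<comment> \<open>Division by 0 gives 0, so at zero cost the formula for the benchmark quantity
    collapses to 0.\<close>
  have "q_star M x v = 0" for x v by (simp add: q_star_def assms(1))
  then have "u_star_exp M \<theta> = 0" by (simp add: u_star_exp_def)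
  moreover have "0 \<le> spot_utility M \<theta>"
    unfolding spot_utility_eq[OF assms(2)] using moment_pos spot_scale_pos gam_pos by simp
  ultimately show ?thesis by simp
qed

text \<open>By Fubini, the point x is counted by all signals from x upwards, which have probability
  1 - F(x). Stopping at y produces the partial integrals that \<open>weighted_integral_ge\<close>
  asks for.\<close>

lemma expectation_stopped_integral:
  fixes d :: "real \<Rightarrow> real"
  assumes d [measurable]: "d \<in> borel_measurable borel" and B: "\<And>x. x \<in> signals M \<Longrightarrow> \<bar>d x\<bar> \<le> B"
    and y: "y \<in> signals M"
  shows "(LINT \<theta>|signal_law M. (LINT x:{th_lo M..min \<theta> y}|lborel. d x)) =
    (LINT x:{th_lo M..y}|lborel. d x * (1 - sig_cdf M x))"
proof -
  interpret SL: pair_sigma_finite "signal_law M" lborel ..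
  let ?P = "signal_law M \<Otimes>\<^sub>M lborel"
  define f where "f \<theta> x = indicat_real {th_lo M..y} x * d x * (if x \<le> \<theta> then 1 else 0)" for \<theta> x :: real
  have int: "integrable ?P (case_prod f)"
  proof (rule integrableI_bounded_set[where A = "(UNIV :: real set) \<times> {th_lo M..y}" and B = B])
    show "(UNIV :: real set) \<times> {th_lo M..y} \<in> sets ?P" by (intro pair_measureI) auto
    show "case_prod f \<in> borel_measurable ?P" unfolding f_def by measurable
    have "emeasure ?P ((UNIV :: real set) \<times> {th_lo M..y}) = emeasure (signal_law M) UNIV * emeasure lborel {th_lo M..y}"
      by (rule lborel.emeasure_pair_measure_Times) auto
    also have "\<dots> < \<infinity>"
      using signal.emeasure_space_1 by (simp add: emeasure_lborel_Icc_eq)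
    finally show "emeasure ?P ((UNIV :: real set) \<times> {th_lo M..y}) < \<infinity>" .
    show "AE p in ?P. p \<in> (UNIV :: real set) \<times> {th_lo M..y} \<longrightarrow> norm (case_prod f p) \<le> B"
    proof (rule AE_I2, rule impI)
      fix p assume "p \<in> (UNIV :: real set) \<times> {th_lo M..y}"
      then have "snd p \<in> signals M" using y by (auto simp: signals_def)
      from B[OF this] show "norm (case_prod f p) \<le> B"
        by (auto simp: f_def case_prod_beta indicator_def)
    qed
    show "AE p in ?P. p \<notin> (UNIV :: real set) \<times> {th_lo M..y} \<longrightarrow> case_prod f p = 0"
      by (rule AE_I2) (auto simp: f_def indicator_def)
  qed
  have "(LINT \<theta>|signal_law M. (LINT x:{th_lo M..min \<theta> y}|lborel. d x)) =
      (LINT \<theta>|signal_law M. (LINT x|lborel. f \<theta> x))"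
    by (intro Bochner_Integration.integral_cong refl)
      (auto simp: set_lebesgue_integral_def f_def indicator_def intro!: Bochner_Integration.integral_cong)
  also have "\<dots> = (LINT x|lborel. (LINT \<theta>|signal_law M. f \<theta> x))"
    using SL.Fubini_integral[OF int] by simp
  also have "\<dots> = (LINT x:{th_lo M..y}|lborel. d x * (1 - sig_cdf M x))"
    unfolding set_lebesgue_integral_def
  proof (intro Bochner_Integration.integral_cong refl)
    fix x
    have "(LINT \<theta>|signal_law M. f \<theta> x) =
        (LINT \<theta>|signal_law M. indicat_real {th_lo M..y} x * d x * indicat_real {x..} \<theta>)"
      by (intro Bochner_Integration.integral_cong) (auto simp: f_def)
    then show "(LINT \<theta>|signal_law M. f \<theta> x) =
        indicat_real {th_lo M..y} x *\<^sub>R (d x * (1 - sig_cdf M x))"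
      by (simp add: sig_cdf_compl)
  qed
  finally show ?thesis .
qed

section \<open>The conditional distribution of the value inside and outside its support\<close>

lemma type_vals_iff: "0 < \<theta> \<Longrightarrow> v \<in> type_vals M \<theta> \<longleftrightarrow> v / \<theta> \<in> {z_lo M<..<z_hi M}"
  by (auto simp: type_vals_def field_simps)

lemma type_vals_subset:
  assumes "\<theta> \<in> signals M"
  shows "type_vals M \<theta> \<subseteq> vals M"
proof
  fix v assume v: "v \<in> type_vals M \<theta>"
  have "0 < \<theta>"
    using v signals_nonneg[OF assms] by (cases "\<theta> = 0") (auto simp: type_vals_def)
  then show "v \<in> vals M"
    using v v_in_vals[OF assms, of "v / \<theta>"] type_vals_iff[of \<theta> v] by simp
qed

lemma type_vals_pos:
  assumes "0 < \<theta>" "v \<in> type_vals M \<theta>"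
  shows "0 < v"
proof -
  have "0 \<le> \<theta> * z_lo M" using assms(1) shocks by simp
  then show ?thesis using assms(2) by (simp add: type_vals_def)
qed

lemma val_dens_outside:
  assumes "0 < \<theta>" "v < \<theta> * z_lo M \<or> \<theta> * z_hi M < v"
  shows "val_dens M \<theta> v = 0"
proof -
  have "v / \<theta> \<notin> {z_lo M..z_hi M}" using assms by (auto simp: field_simps)
  then show ?thesis using shock_dens_outside by (simp add: val_dens_def)
qed

lemma shock_cdf_below: "x < z_lo M \<Longrightarrow> cdf (shock_law M) x = 0"
proof -
  assume "x < z_lo M"
  then have "AE z in shock_law M. z \<notin> {..x}" using AE_shock by (auto elim!: eventually_rev_mp)
  then show ?thesis by (simp add: cdf_def shock.prob_eq_0)
qed

lemma shock_cdf_above: "z_hi M < x \<Longrightarrow> cdf (shock_law M) x = 1"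
proof -
  assume "z_hi M < x"
  then have "AE z in shock_law M. z \<in> {..x}" using AE_shock by (auto elim!: eventually_rev_mp)
  then show ?thesis by (simp add: cdf_def shock.prob_eq_1)
qed

lemma deriv_val_cdf_outside:
  assumes "0 < \<theta>" "v < \<theta> * z_lo M \<or> \<theta> * z_hi M < v"
  shows "deriv (\<lambda>x. val_cdf M x v) \<theta> = 0"
proof -
  obtain S k where S: "open S" "\<theta> \<in> S" "\<And>x. x \<in> S \<Longrightarrow> val_cdf M x v = k"
  proof (cases "v < \<theta> * z_lo M")
    case True
    show ?thesis
    proof
      show "open ({0<..} \<inter> {x. v < x * z_lo M})"
        by (intro open_Int open_greaterThan open_Collect_less continuous_intros)
      show "val_cdf M x v = 0" if "x \<in> {0<..} \<inter> {x. v < x * z_lo M}" for x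
        using that by (subst val_cdf_eq) (auto intro!: shock_cdf_below simp: field_simps)
    qed (use True assms in auto)
  next
    case False
    show ?thesis
    proof
      show "open ({0<..} \<inter> {x. x * z_hi M < v})"
        by (intro open_Int open_greaterThan open_Collect_less continuous_intros)
      show "val_cdf M x v = 1" if "x \<in> {0<..} \<inter> {x. x * z_hi M < v}" for x
        using that by (subst val_cdf_eq) (auto intro!: shock_cdf_above simp: field_simps)
    qed (use False assms in auto)
  qed
  have "((\<lambda>x. val_cdf M x v) has_real_derivative 0) (at \<theta>)"
    using S by (intro has_field_derivative_transform_within_open[OF DERIV_const[of k]]) auto
  then show ?thesis by (rule DERIV_imp_deriv)
qed

end

section \<open>The cutoff\<close>

locale screening_cutoff = screening_model +
  fixes \<theta>s :: real
  assumes \<theta>s: "\<theta>s \<in> signals M"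
    and cutoff: "virtual_type M \<theta>s / \<theta>s = cost M / spot_price M"
    and cost_pos: "0 < cost M"
begin

abbreviation "markup \<equiv> 1 - cost M / spot_price M"

lemma markup: "0 < markup" "markup < 1"
  using spot_price cost_pos spot_price_pos by auto

text \<open>The right side of the cutoff equation lies strictly between 0 and 1, which excludes the
  degenerate cases: a zero signal would make the left side 0 by the convention for division, and a
  zero density or F = 1 would make it 1.\<close>

lemma cutoff_props:
  shows "0 < \<theta>s" "0 < sig_dens M \<theta>s" "\<theta>s < th_hi M"
    and "(1 - sig_cdf M \<theta>s) / sig_dens M \<theta>s = markup * \<theta>s"
proof -
  have r: "0 < cost M / spot_price M" "cost M / spot_price M < 1"
    using spot_price cost_pos spot_price_pos by auto
  have "\<theta>s \<noteq> 0" using cutoff r by auto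
  then show pos: "0 < \<theta>s" using signals_nonneg[OF \<theta>s] by simp
  have "virtual_type M \<theta>s \<noteq> \<theta>s" using cutoff r pos by auto
  then have ne: "(1 - sig_cdf M \<theta>s) / sig_dens M \<theta>s \<noteq> 0" by (simp add: virtual_type_def)
  then show "0 < sig_dens M \<theta>s" using sig_dens_nonneg[of \<theta>s] by (simp add: less_le)
  have "\<theta>s \<noteq> th_hi M" using ne sig_cdf_th_hi by auto
  then show "\<theta>s < th_hi M" using \<theta>s by (simp add: signals_def)
  have "virtual_type M \<theta>s = (1 - markup) * \<theta>s" using cutoff pos by (simp add: divide_eq_eq)
  then show "(1 - sig_cdf M \<theta>s) / sig_dens M \<theta>s = markup * \<theta>s"
    by (simp add: virtual_type_def algebra_simps)
qed

text \<open>
  The optimal allocation is efficient for the distorted value \<open>eff_ratio \<theta> * v\<close>; below the cutoff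
  this is the quantity that the buyer would purchase on the spot market.
\<close>

definition eff_ratio :: "real \<Rightarrow> real" where
  "eff_ratio \<theta> = (if \<theta> \<le> \<theta>s then cost M / spot_price M else virtual_type M \<theta> / \<theta>)"

lemma eff_ratio_measurable [measurable]: "eff_ratio \<in> borel_measurable borel"
  using sig_dens_measurable unfolding eff_ratio_def virtual_type_def by measurable

lemma virtual_ratio_le_1: "0 < \<theta> \<Longrightarrow> virtual_type M \<theta> / \<theta> \<le> 1"
  using sig_cdf_bounds sig_dens_nonneg by (simp add: virtual_type_def)

lemma hazard_antimono:
  assumes "x \<in> signals M" "y \<in> signals M" "x \<le> y" "0 < sig_dens M x" "0 < sig_dens M y"
  shows "(1 - sig_cdf M y) / sig_dens M y \<le> (1 - sig_cdf M x) / sig_dens M x"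
  using monotone_hazard_rate assms by (auto simp: monotone_on_def)

lemma virtual_ratio_mono:
  assumes "x \<in> signals M" "y \<in> signals M" "0 < x" "x \<le> y" "0 < sig_dens M x" "0 < sig_dens M y"
  shows "virtual_type M x / x \<le> virtual_type M y / y"
proof -
  have "(1 - sig_cdf M y) / sig_dens M y / y \<le> (1 - sig_cdf M x) / sig_dens M x / x"
    using assms sig_cdf_bounds
    by (intro frac_le[OF _ hazard_antimono[OF assms(1,2,4-6)]]) auto
  then show ?thesis using assms by (simp add: virtual_type_def diff_divide_distrib)
qed

text \<open>The inverse hazard rate is only weakly decreasing; strictness comes from dividing it by
  \<theta>, since \<open>markup * \<theta>s / \<theta>\<close> exceeds \<open>markup\<close> below
  the cutoff.\<close>

lemma virtual_ratio_below:
  assumes "\<theta> \<in> signals M" "0 < \<theta>" "\<theta> < \<theta>s" "0 < sig_dens M \<theta>"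
  shows "virtual_type M \<theta> / \<theta> < cost M / spot_price M"
proof -
  note c = cutoff_props
  have h: "0 < markup * \<theta>s" using markup c by simp
  have "markup * \<theta>s \<le> (1 - sig_cdf M \<theta>) / sig_dens M \<theta>"
    using hazard_antimono[OF assms(1) \<theta>s] assms c by simp
  then have "markup * \<theta>s / \<theta> \<le> (1 - sig_cdf M \<theta>) / sig_dens M \<theta> / \<theta>"
    using assms(2) by (intro divide_right_mono) auto
  moreover have "markup < markup * \<theta>s / \<theta>"
    using mult_strict_left_mono[OF assms(3) markup(1)] assms(2) by (simp add: pos_less_divide_eq)
  ultimately show ?thesis using assms(2) by (simp add: virtual_type_def diff_divide_distrib)
qed

lemma virtual_type_th_hi: "virtual_type M (th_hi M) = th_hi M"
  by (simp add: virtual_type_def sig_cdf_th_hi)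

lemma th_hi_pos: "0 < th_hi M"
  using signals by simp

text \<open>The left signal can be moved up to the cutoff, where the density is positive, so a
  vanishing density at the lowest signal does no harm. At the highest signal F = 1 makes the ratio
  1, its upper bound, whatever the density.\<close>

lemma eff_ratio_mono:
  assumes "x \<in> signals M" "y \<in> signals M" "x \<le> y"
  shows "eff_ratio x \<le> eff_ratio y"
proof (cases "y \<le> \<theta>s \<or> y = x")
  case False
  have c: "0 < \<theta>s" "0 < sig_dens M \<theta>s" using cutoff_props by auto
  let ?x = "max x \<theta>s"
  have x: "?x \<in> signals M" "0 < ?x" "?x < y" using False assms c \<theta>s by (auto simp: max_def)
  have fx: "0 < sig_dens M ?x"
    using c sig_dens_pos[of x] x assms \<theta>s by (auto simp: max_def signals_def)
  have "virtual_type M ?x / ?x \<le> virtual_type M y / y"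
  proof (cases "y = th_hi M")
    case True
    then show ?thesis using virtual_ratio_le_1[OF x(2)] th_hi_pos by (simp add: virtual_type_th_hi)
  next
    case False
    then have "0 < sig_dens M y"
      using x assms by (intro sig_dens_pos) (auto simp: signals_def)
    then show ?thesis using virtual_ratio_mono[OF x(1) assms(2) x(2)] x(3) fx by simp
  qed
  moreover have "eff_ratio x = virtual_type M ?x / ?x"
    using cutoff by (auto simp: eff_ratio_def max_def)
  ultimately show ?thesis using False by (simp add: eff_ratio_def)
qed (use assms(3) in \<open>auto simp: eff_ratio_def\<close>)

lemma eff_ratio_th_lo: "eff_ratio (th_lo M) = cost M / spot_price M"
  using \<theta>s by (simp add: eff_ratio_def signals_def)

lemma eff_ratio_bounds:
  assumes "\<theta> \<in> signals M"
  shows "cost M / spot_price M \<le> eff_ratio \<theta>" "eff_ratio \<theta> \<le> 1" "0 < eff_ratio \<theta>"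
proof -
  show ge: "cost M / spot_price M \<le> eff_ratio \<theta>"
    using eff_ratio_mono[OF th_lo_in assms] assms unfolding eff_ratio_th_lo by (simp add: signals_def)
  show "eff_ratio \<theta> \<le> 1"
    using markup(1) virtual_ratio_le_1[of \<theta>] cutoff_props(1) by (auto simp: eff_ratio_def)
  show "0 < eff_ratio \<theta>"
    using ge markup(2) by linarith
qed

text \<open>The price of the rent slope. Above the cutoff it is the inverse hazard rate, as without
  a spot market; below, the participation constraint reduces it to
  \<open>markup * \<theta>\<close>.\<close>

definition wedge :: "real \<Rightarrow> real" where
  "wedge \<theta> = \<theta> * (1 - eff_ratio \<theta>)"

lemma wedge_measurable [measurable]: "wedge \<in> borel_measurable borel"
  unfolding wedge_def by measurable

lemma wedge_bounded:
  assumes "\<theta> \<in> signals M"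
  shows "\<bar>wedge \<theta>\<bar> \<le> th_hi M"
proof -
  have "\<theta> * (1 - eff_ratio \<theta>) \<le> \<theta> * 1"
    using eff_ratio_bounds[OF assms] signals_nonneg[OF assms] by (intro mult_left_mono) auto
  moreover have "0 \<le> \<theta> * (1 - eff_ratio \<theta>)"
    using eff_ratio_bounds[OF assms] signals_nonneg[OF assms] by simp
  ultimately show ?thesis using assms by (simp add: wedge_def signals_def)
qed

lemma wedge_dens_below: "\<theta> \<le> \<theta>s \<Longrightarrow> wedge \<theta> * sig_dens M \<theta> = markup * \<theta> * sig_dens M \<theta>"
  by (simp add: wedge_def eff_ratio_def)

lemma wedge_dens_above:
  assumes "\<theta>s < \<theta>" "\<theta> < th_hi M"
  shows "wedge \<theta> * sig_dens M \<theta> = 1 - sig_cdf M \<theta>"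
proof -
  have "0 < sig_dens M \<theta>" "0 < \<theta>"
    using assms \<theta>s cutoff_props(1) by (auto intro!: sig_dens_pos simp: signals_def)
  then show ?thesis
    using assms by (simp add: wedge_def eff_ratio_def virtual_type_def field_simps)
qed

text \<open>
  The multiplier on the participation constraint of the types below \<open>\<theta>s\<close> has distribution
  function \<open>1 - (1 - F) * slack\<close>, which is nondecreasing because of the hazard rate condition.
\<close>

definition slack :: "real \<Rightarrow> real" where
  "slack x = 1 - markup * x * sig_dens M x / (1 - sig_cdf M x)"

lemma slack_antimono:
  assumes "th_lo M \<le> x" "x \<le> y" "y \<le> \<theta>s"
  shows "slack y \<le> slack x"
proof (cases "x = y")
  case False
  have s: "x \<in> signals M" "y \<in> signals M" using assms \<theta>s by (auto simp: signals_def)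
  have F: "sig_cdf M x < 1" "sig_cdf M y < 1"
    using assms cutoff_props(3) by (auto intro!: sig_cdf_less_1)
  have fy: "0 < sig_dens M y"
    using False assms cutoff_props(3) by (intro sig_dens_pos) auto
  have "sig_dens M x / (1 - sig_cdf M x) \<le> sig_dens M y / (1 - sig_cdf M y)"
  \<comment> \<open>This happens at most at the lowest signal, which the hazard rate condition
    leaves out when the density vanishes there; the reciprocal hazard quotient is then simply
    0.\<close>
  proof (cases "sig_dens M x = 0")
    case True
    then show ?thesis using fy F by simp
  next
    case False
    then have "0 < sig_dens M x" using sig_dens_nonneg[of x] by simp
    then show ?thesis
      using hazard_antimono[OF s assms(2) _ fy] F fy by (simp add: field_simps)
  qed
  then have "x * (sig_dens M x / (1 - sig_cdf M x)) \<le> y * (sig_dens M y / (1 - sig_cdf M y))"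
    using assms(2) signals_nonneg[OF s(2)] sig_dens_nonneg[of x] F by (intro mult_mono) auto
  then have "markup * (x * (sig_dens M x / (1 - sig_cdf M x))) \<le> markup * (y * (sig_dens M y / (1 - sig_cdf M y)))"
    using markup by (intro mult_left_mono) auto
  then show ?thesis by (simp add: slack_def mult.assoc)
qed simp

lemma slack_cutoff: "slack \<theta>s = 0"
proof -
  have F: "sig_cdf M \<theta>s < 1" using sig_cdf_less_1 cutoff_props(3) by blast
  have "1 - sig_cdf M \<theta>s = markup * \<theta>s * sig_dens M \<theta>s"
    using cutoff_props(2,4) by (simp add: divide_eq_eq)
  then show ?thesis unfolding slack_def using F by (metis diff_gt_0_iff_gt diff_self divide_self less_irrefl)
qed

lemma slack_le_1: "slack (th_lo M) \<le> 1"
  using markup signals sig_dens_nonneg sig_cdf_bounds by (simp add: slack_def)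

lemma slack_compl:
  assumes "x \<le> \<theta>s"
  shows "(1 - slack x) * (1 - sig_cdf M x) = wedge x * sig_dens M x"
proof -
  have "sig_cdf M x < 1" using assms cutoff_props(3) by (intro sig_cdf_less_1) auto
  then show ?thesis by (simp add: slack_def wedge_dens_below[OF assms])
qed

text \<open>By Fubini, E[D] is D at the lowest signal plus the integral of d (1 - F). The weight
  \<open>wedge\<close> times the density is 1 - F above the cutoff and (1 - \<open>slack\<close>) (1
  - F) below it. So E[D] - E[\<open>wedge\<close> d] is D at the lowest signal plus the integral of
  \<open>slack\<close> d (1 - F) up to the cutoff. \<open>weighted_integral_ge\<close> bounds that
  integral from below by minus D at the lowest signal.\<close>

lemma expectation_ge_wedge:
  fixes D d :: "real \<Rightarrow> real"
  assumes d [measurable]: "d \<in> borel_measurable borel" and B: "\<And>x. x \<in> signals M \<Longrightarrow> \<bar>d x\<bar> \<le> B"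
    and D: "\<And>\<theta>. \<theta> \<in> signals M \<Longrightarrow> D \<theta> = D (th_lo M) + (LINT x:{th_lo M..\<theta>}|lborel. d x)"
    and D_meas [measurable]: "D \<in> borel_measurable borel"
    and D_nonneg: "\<And>\<theta>. \<theta> \<in> signals M \<Longrightarrow> \<theta> \<le> \<theta>s \<Longrightarrow> 0 \<le> D \<theta>"
  shows "(LINT \<theta>|signal_law M. wedge \<theta> * d \<theta>) \<le> (LINT \<theta>|signal_law M. D \<theta>)"
proof -
  let ?g = "\<lambda>x. d x * (1 - sig_cdf M x)"
  have lo: "th_lo M \<le> \<theta>s" "\<theta>s \<le> th_hi M" using \<theta>s by (auto simp: signals_def)
  have B0: "0 \<le> B" using B[OF th_lo_in] by linarith
  have gB: "\<bar>?g x\<bar> \<le> B" if "x \<in> signals M" for x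
  proof -
    have "\<bar>d x\<bar> * \<bar>1 - sig_cdf M x\<bar> \<le> B * 1"
      using B[OF that] B0 sig_cdf_bounds[of x] by (intro mult_mono) auto
    then show ?thesis by (simp add: abs_mult)
  qed
  have gint: "set_integrable lborel {x..y} ?g" if "x \<in> signals M" "y \<in> signals M" for x y
    by (rule set_integrable_bounded_on[where B = B]) (use that gB in \<open>auto simp: signals_def\<close>)
  have stop: "(LINT \<theta>|signal_law M. D (min \<theta> y)) = D (th_lo M) + (LINT x:{th_lo M..y}|lborel. ?g x)" if y: "y \<in> signals M" for y
  proof -
    let ?I = "\<lambda>\<theta>. LINT x:{th_lo M..min \<theta> y}|lborel. d x"
    have I_meas: "?I \<in> borel_measurable borel"
      unfolding set_lebesgue_integral_def
      by (rule lborel.borel_measurable_lebesgue_integral) (simp add: indicator_def case_prod_beta, measurable)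
    have I_bound: "\<bar>?I \<theta>\<bar> \<le> B * (th_hi M - th_lo M)" if "\<theta> \<in> signals M" for \<theta>
    proof -
      have s: "min \<theta> y \<in> signals M" using that y by (auto simp: min_def)
      have i: "set_integrable lborel {th_lo M..min \<theta> y} d"
        by (rule set_integrable_bounded_on[where B = B])
          (use s B in \<open>auto simp: signals_def\<close>)
      have ic: "set_integrable lborel {th_lo M..min \<theta> y} (\<lambda>_. c)" for c :: real
        by (rule set_integrable_bounded_on[where B = "\<bar>c\<bar>"]) (use s in auto)
      have dB: "- B \<le> d x" "d x \<le> B" if "x \<in> {th_lo M..min \<theta> y}" for x
      proof -
        have "x \<in> signals M" using that s by (auto simp: signals_def)
        from B[OF this] show "- B \<le> d x" "d x \<le> B" by linarith+
      qed
      have "?I \<theta> \<le> (LINT x:{th_lo M..min \<theta> y}|lborel. B)"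
        using i ic dB by (intro set_integral_mono) auto
      moreover have "(LINT x:{th_lo M..min \<theta> y}|lborel. - B) \<le> ?I \<theta>"
        using i ic dB by (intro set_integral_mono) auto
      moreover have "th_lo M \<le> min \<theta> y" using s by (simp add: signals_def)
      then have "(LINT x:{th_lo M..min \<theta> y}|lborel. B) = B * (min \<theta> y - th_lo M)"
        "(LINT x:{th_lo M..min \<theta> y}|lborel. - B) = - (B * (min \<theta> y - th_lo M))"
        using set_integral_Icc_const by (simp_all only: minus_mult_left)
      moreover have "B * (min \<theta> y - th_lo M) \<le> B * (th_hi M - th_lo M)"
        using B0 s by (intro mult_left_mono) (auto simp: signals_def)
      ultimately show ?thesis by linarith
    qed
    have Iint: "integrable (signal_law M) ?I"
      by (rule integrable_signal_bounded[OF I_meas I_bound])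
    have Dm: "(\<lambda>\<theta>. D (min \<theta> y)) \<in> borel_measurable (signal_law M)"
      by (rule measurable_compose[OF _ D_meas]) measurable
    have eq: "AE \<theta> in signal_law M. D (min \<theta> y) = D (th_lo M) + ?I \<theta>"
      using AE_signal
    proof eventually_elim
      case (elim \<theta>)
      then have "min \<theta> y \<in> signals M" using y by (auto simp: signals_def min_def)
      then show ?case by (rule D)
    qed
    have "(LINT \<theta>|signal_law M. D (min \<theta> y)) = (LINT \<theta>|signal_law M. D (th_lo M) + ?I \<theta>)"
      using eq Dm borel_measurable_integrable[OF Iint] by (intro integral_cong_AE) auto
    also have "\<dots> = D (th_lo M) + (LINT \<theta>|signal_law M. ?I \<theta>)"
      using Iint signal.prob_space by (subst Bochner_Integration.integral_add) auto
    finally show ?thesis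
      using expectation_stopped_integral[OF d B y] by simp
  qed
  \<comment> \<open>The stopped signal never passes the cutoff, so D is nonnegative there and so is
    its expectation.\<close>
  have partial: "- D (th_lo M) \<le> (LINT x:{th_lo M..y}|lborel. ?g x)" if "y \<in> {th_lo M..\<theta>s}" for y
  proof -
    have y: "y \<in> signals M" using that lo by (auto simp: signals_def)
    have "0 \<le> (LINT \<theta>|signal_law M. D (min \<theta> y))"
    proof (rule integral_nonneg_AE)
      show "AE \<theta> in signal_law M. 0 \<le> D (min \<theta> y)"
        using AE_signal by eventually_elim
          (use that y in \<open>auto intro!: D_nonneg simp: signals_def min_def\<close>)
    qed
    then show ?thesis using stop[OF y] by simp
  qed
  have slack_meas: "slack \<in> borel_measurable borel"
    using sig_dens_measurable unfolding slack_def by measurable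
  note W = weighted_integral_ge[OF lo(1) gint[OF th_lo_in \<theta>s] slack_meas slack_antimono slack_cutoff
      slack_le_1 D_nonneg[OF th_lo_in lo(1)] partial]
  let ?w = "\<lambda>\<theta>. wedge \<theta> * d \<theta>"
  have wint: "integrable (signal_law M) ?w"
  proof (rule integrable_signal_bounded)
    show "\<bar>?w \<theta>\<bar> \<le> th_hi M * B" if "\<theta> \<in> signals M" for \<theta>
      unfolding abs_mult using wedge_bounded[OF that] B[OF that] th_hi_pos by (intro mult_mono) auto
  qed measurable
  then have wint': "set_integrable lborel {th_lo M..th_hi M} (\<lambda>\<theta>. ?w \<theta> * sig_dens M \<theta>)"
    using integral_signal_eq(2)[of ?w] by (simp add: signals_def)
  have "(LINT \<theta>|signal_law M. ?w \<theta>) = (LINT \<theta>:{th_lo M..th_hi M}|lborel. ?w \<theta> * sig_dens M \<theta>)"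
    using integral_signal_eq(1)[of ?w] by (simp add: signals_def)
  also have "\<dots> = (LINT \<theta>:{th_lo M..\<theta>s}|lborel. ?w \<theta> * sig_dens M \<theta>)
      + (LINT \<theta>:{\<theta>s..th_hi M}|lborel. ?w \<theta> * sig_dens M \<theta>)"
    by (rule set_integral_Icc_combine[OF wint' lo])
  also have "(LINT \<theta>:{th_lo M..\<theta>s}|lborel. ?w \<theta> * sig_dens M \<theta>) =
      (LINT \<theta>:{th_lo M..\<theta>s}|lborel. ?g \<theta> - slack \<theta> * ?g \<theta>)"
  proof (rule set_lebesgue_integral_cong; (intro allI impI)?)
    fix \<theta> assume "\<theta> \<in> {th_lo M..\<theta>s}"
    then have "d \<theta> * ((1 - slack \<theta>) * (1 - sig_cdf M \<theta>)) = d \<theta> * (wedge \<theta> * sig_dens M \<theta>)"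
      using slack_compl[of \<theta>] by simp
    then show "?w \<theta> * sig_dens M \<theta> = ?g \<theta> - slack \<theta> * ?g \<theta>" by (simp add: algebra_simps)
  qed simp
  also have "\<dots> = (LINT \<theta>:{th_lo M..\<theta>s}|lborel. ?g \<theta>) - (LINT \<theta>:{th_lo M..\<theta>s}|lborel. slack \<theta> * ?g \<theta>)"
    by (rule set_integral_diff(2)[OF gint[OF th_lo_in \<theta>s] W(1)])
  also have "(LINT \<theta>:{\<theta>s..th_hi M}|lborel. ?w \<theta> * sig_dens M \<theta>) = (LINT \<theta>:{\<theta>s..th_hi M}|lborel. ?g \<theta>)"
  proof (rule set_lebesgue_integral_cong_AE)
    show "AE \<theta>\<in>{\<theta>s..th_hi M} in lborel. ?w \<theta> * sig_dens M \<theta> = ?g \<theta>"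
      using AE_lborel_singleton[of \<theta>s] AE_lborel_singleton[of "th_hi M"]
    proof eventually_elim
      case (elim \<theta>)
      show ?case
      proof
        assume "\<theta> \<in> {\<theta>s..th_hi M}"
        then have "wedge \<theta> * sig_dens M \<theta> = 1 - sig_cdf M \<theta>"
          using elim by (intro wedge_dens_above) auto
        then have "d \<theta> * (wedge \<theta> * sig_dens M \<theta>) = ?g \<theta>" by simp
        then show "?w \<theta> * sig_dens M \<theta> = ?g \<theta>" by (simp add: mult_ac)
      qed
    qed
  qed (use sig_dens_measurable in measurable)
  finally have "(LINT \<theta>|signal_law M. ?w \<theta>) =
      (LINT \<theta>:{th_lo M..\<theta>s}|lborel. ?g \<theta>) - (LINT \<theta>:{th_lo M..\<theta>s}|lborel. slack \<theta> * ?g \<theta>)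
      + (LINT \<theta>:{\<theta>s..th_hi M}|lborel. ?g \<theta>)" .
  also have "\<dots> \<le> D (th_lo M) + (LINT \<theta>:{th_lo M..th_hi M}|lborel. ?g \<theta>)"
    using W(2) set_integral_Icc_combine[OF gint[OF th_lo_in th_hi_in] lo] by simp
  also have "\<dots> = (LINT \<theta>|signal_law M. D (min \<theta> (th_hi M)))"
    by (rule stop[OF th_hi_in, symmetric])
  also have "\<dots> = (LINT \<theta>|signal_law M. D \<theta>)"
  proof (rule integral_cong_AE)
    show "AE \<theta> in signal_law M. D (min \<theta> (th_hi M)) = D \<theta>"
      using AE_signal by eventually_elim (simp add: min_def)
  qed auto
  finally show ?thesis .
qed

end

section \<open>Optimality and uniqueness\<close>

context screening_cutoff
begin

definition scale :: "real \<Rightarrow> real" where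
  "scale \<theta> = (alpha M * eff_ratio \<theta> / cost M) powr bet"

lemma scale_measurable [measurable]: "scale \<in> borel_measurable borel"
  unfolding scale_def by measurable

lemma scale_mono:
  assumes "x \<in> signals M" "y \<in> signals M" "x \<le> y"
  shows "scale x \<le> scale y"
  unfolding scale_def using eff_ratio_mono[OF assms] eff_ratio_bounds[OF assms(1)] alpha cost_pos bet_pos
  by (intro powr_mono2 divide_right_mono mult_left_mono) auto

text \<open>The cost cancels: \<open>alpha M\<close> times the ratio of cost to spot price, divided
  by cost, is \<open>alpha M\<close> over the spot price.\<close>

lemma scale_below: "\<theta> \<le> \<theta>s \<Longrightarrow> scale \<theta> = spot_scale"
  using cost_pos by (simp add: scale_def spot_scale_def eff_ratio_def)

lemma scale_ge: "\<theta> \<in> signals M \<Longrightarrow> spot_scale \<le> scale \<theta>"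
  using scale_below[of "th_lo M"] scale_mono[OF th_lo_in] \<theta>s by (simp add: signals_def)

lemmas scale = scale_measurable scale_mono scale_ge

abbreviation "q_cut \<equiv> scaled_q scale"
abbreviation "t_cut \<equiv> scaled_t scale"

lemma q_cut_eq:
  assumes "\<theta> \<in> signals M"
  shows "q_cut \<theta> v = (alpha M * (eff_ratio \<theta> * v) / cost M) powr gam"
proof -
  have "scale \<theta> powr (1 / alpha M) = (alpha M * eff_ratio \<theta> / cost M) powr gam"
    using alpha by (simp add: scale_def powr_powr)
  then have "q_cut \<theta> v = (alpha M * eff_ratio \<theta> / cost M * v) powr gam"
    by (simp only: scaled_q_def powr_mult)
  then show ?thesis by (simp only: times_divide_eq_left mult.assoc)
qed

lemma cut_feasible: "feasible M q_cut t_cut"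
  using scale by (rule scaled_feasible)

lemma feasibleD:
  assumes "feasible M q t"
  shows "mechanism M q t" "IC1 M q t" "IC0 M q t"
    and "\<And>\<theta>. \<theta> \<in> signals M \<Longrightarrow> spot_utility M \<theta> \<le> rent q t \<theta>"
proof -
  show m: "mechanism M q t" "IC1 M q t" "IC0 M q t" using assms by (auto simp: feasible_def)
  show "\<And>\<theta>. \<theta> \<in> signals M \<Longrightarrow> spot_utility M \<theta> \<le> rent q t \<theta>"
    using assms by (auto simp: feasible_def spot_participation_def gross_rent_eq[OF m(1)])
qed

lemmas cutD = feasibleD[OF cut_feasible]

definition virtual_surplus :: "(real \<Rightarrow> real \<Rightarrow> real) \<Rightarrow> real \<Rightarrow> real" where
  "virtual_surplus q \<theta> = surplus q \<theta> - wedge \<theta> * slope q \<theta>"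

lemma virtual_surplus_integrand:
  assumes "feasible M q t" "\<theta> \<in> signals M"
  shows "integrable (shock_law M) (\<lambda>z. eff_ratio \<theta> * (\<theta> * z) * q \<theta> (\<theta> * z) powr alpha M - cost M * q \<theta> (\<theta> * z))"
    and "virtual_surplus q \<theta> = (LINT z|shock_law M.
      eff_ratio \<theta> * (\<theta> * z) * q \<theta> (\<theta> * z) powr alpha M - cost M * q \<theta> (\<theta> * z))"
proof -
  note m = feasibleD[OF assms(1)]
  note i = integrable_q[OF m(1,2) assms(2,2)] integrable_q_powr[OF m(1,2) assms(2,2)]
  have eq: "(\<lambda>z. eff_ratio \<theta> * (\<theta> * z) * q \<theta> (\<theta> * z) powr alpha M - cost M * q \<theta> (\<theta> * z)) =
      (\<lambda>z. eff_ratio \<theta> * \<theta> * (z * q \<theta> (\<theta> * z) powr alpha M) - cost M * q \<theta> (\<theta> * z))"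
    by (simp add: mult_ac)
  show "integrable (shock_law M) (\<lambda>z. eff_ratio \<theta> * (\<theta> * z) * q \<theta> (\<theta> * z) powr alpha M - cost M * q \<theta> (\<theta> * z))"
    unfolding eq using i by simp
  show "virtual_surplus q \<theta> = (LINT z|shock_law M.
      eff_ratio \<theta> * (\<theta> * z) * q \<theta> (\<theta> * z) powr alpha M - cost M * q \<theta> (\<theta> * z))"
  proof -
    have "(LINT z|shock_law M. eff_ratio \<theta> * \<theta> * (z * q \<theta> (\<theta> * z) powr alpha M) - cost M * q \<theta> (\<theta> * z))
        = eff_ratio \<theta> * \<theta> * slope q \<theta> - cost M * (LINT z|shock_law M. q \<theta> (\<theta> * z))"
      using i by (simp add: slope_def)
    then show ?thesis
      unfolding eq virtual_surplus_def surplus_eq[OF m(1,2) assms(2)] wedge_def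
      by (simp add: algebra_simps)
  qed
qed

text \<open>The candidate maximizes the integrand for each shock. If the integrals agree, the
  nonnegative difference of the integrands vanishes almost everywhere, and uniqueness of the
  pointwise maximizer identifies the quantities.\<close>

lemma virtual_surplus_maximal:
  assumes f: "feasible M q t" and \<theta>: "\<theta> \<in> signals M"
  shows "virtual_surplus q \<theta> \<le> virtual_surplus q_cut \<theta>"
    and "virtual_surplus q \<theta> = virtual_surplus q_cut \<theta> \<Longrightarrow>
      AE z in shock_law M. q \<theta> (\<theta> * z) = q_cut \<theta> (\<theta> * z)"
proof -
  note m = feasibleD[OF f]
  let ?k = "\<lambda>q z. eff_ratio \<theta> * (\<theta> * z) * q \<theta> (\<theta> * z) powr alpha M - cost M * q \<theta> (\<theta> * z)"
  note i = virtual_surplus_integrand(1)[OF f \<theta>] virtual_surplus_integrand(1)[OF cut_feasible \<theta>]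
  note e = virtual_surplus_integrand(2)[OF f \<theta>] virtual_surplus_integrand(2)[OF cut_feasible \<theta>]
  have pt: "?k q z \<le> ?k q_cut z \<and> (?k q z = ?k q_cut z \<longrightarrow> q \<theta> (\<theta> * z) = q_cut \<theta> (\<theta> * z))"
    if z: "z \<in> {z_lo M<..<z_hi M}" for z
  proof -
    have v: "\<theta> * z \<in> vals M" by (rule v_in_vals[OF \<theta>]) (use z in auto)
    have x: "0 \<le> eff_ratio \<theta> * (\<theta> * z)"
      using eff_ratio_bounds[OF \<theta>] vals_nonneg[OF v] by simp
    show ?thesis
      using powr_surplus_le[OF alpha cost_pos x q_nonneg[OF m(1) \<theta> v]]
      unfolding q_cut_eq[OF \<theta>] by blast
  qed
  show "virtual_surplus q \<theta> \<le> virtual_surplus q_cut \<theta>"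
    unfolding e using i pt by (intro integral_shock_mono) auto
  show "AE z in shock_law M. q \<theta> (\<theta> * z) = q_cut \<theta> (\<theta> * z)"
    if "virtual_surplus q \<theta> = virtual_surplus q_cut \<theta>"
  proof -
    have nn: "AE z in shock_law M. 0 \<le> ?k q_cut z - ?k q z"
      using AE_shock by eventually_elim (use pt in simp)
    have "(LINT z|shock_law M. ?k q_cut z - ?k q z) = 0"
      using that i unfolding e by simp
    then have "AE z in shock_law M. ?k q_cut z - ?k q z = 0"
      using integral_nonneg_eq_0_iff_AE[OF Bochner_Integration.integrable_diff[OF i(2,1)] nn] by simp
    with AE_shock show ?thesis
    proof eventually_elim
      case (elim z)
      then show ?case using pt[OF elim(1)] by simp
    qed
  qed
qed

lemma slope_bound:
  assumes "feasible M q t" "\<theta> \<in> signals M"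
  shows "\<bar>slope q \<theta>\<bar> \<le> slope q (th_hi M)"
  using slope_bounded[OF feasibleD(1-3)[OF assms(1)] assms(2)] .

lemma slope_meas: "feasible M q t \<Longrightarrow> slope q \<in> borel_measurable borel"
  using measurable_slope feasibleD(1) by blast

lemma integrable_virtual_surplus:
  assumes "feasible M q t"
  shows "integrable (signal_law M) (\<lambda>\<theta>. wedge \<theta> * slope q \<theta>)"
    and "integrable (signal_law M) (virtual_surplus q)"
proof -
  note [measurable] = slope_meas[OF assms]
  show w: "integrable (signal_law M) (\<lambda>\<theta>. wedge \<theta> * slope q \<theta>)"
  proof (rule integrable_signal_bounded)
    show "\<bar>wedge \<theta> * slope q \<theta>\<bar> \<le> th_hi M * slope q (th_hi M)" if "\<theta> \<in> signals M" for \<theta>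
      unfolding abs_mult using wedge_bounded[OF that] slope_bound[OF assms that] th_hi_pos
      by (intro mult_mono) auto
  qed measurable
  show "integrable (signal_law M) (virtual_surplus q)"
    unfolding virtual_surplus_def
    using payoff_eq_surplus_minus_rent(1)[OF feasibleD(1-3)[OF assms]] w by simp
qed

lemma rent_cut: "\<theta> \<in> signals M \<Longrightarrow> rent q_cut t_cut \<theta> = scaled_rent scale \<theta>"
  using scale by (rule scaled_rent_eq)

lemma rent_cut_below: "\<theta> \<in> signals M \<Longrightarrow> \<theta> \<le> \<theta>s \<Longrightarrow> scaled_rent scale \<theta> = spot_utility M \<theta>"
  using scaled_rent_eq_spot[OF scale] scale_below by blast

section \<open>Upper bound for the payoff of a feasible mechanism\<close>

context
  fixes q t :: "real \<Rightarrow> real \<Rightarrow> real"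
  assumes f: "feasible M q t"
begin

lemma rent_gap:
  assumes "\<theta> \<in> signals M"
  shows "rent q t \<theta> - rent q_cut t_cut \<theta> = rent q t (th_lo M) - rent q_cut t_cut (th_lo M)
    + (LINT x:{th_lo M..\<theta>}|lborel. slope q x - slope q_cut x)"
proof -
  have i: "set_integrable lborel {th_lo M..\<theta>} (slope q')" if "feasible M q' t'" for q' t'
    by (rule set_integrable_bounded_on[OF slope_meas[OF that] slope_bound[OF that]])
      (use assms in \<open>auto simp: signals_def\<close>)
  have le: "th_lo M \<le> \<theta>" using assms by (simp add: signals_def)
  show ?thesis
    using rent_eq_integral[OF feasibleD(1-3)[OF f] th_lo_in assms le]
      rent_eq_integral[OF cutD(1-3) th_lo_in assms le]
      set_integral_diff(2)[OF i[OF f] i[OF cut_feasible]] by simp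
qed

lemma rent_gap_nonneg:
  assumes "\<theta> \<in> signals M" "\<theta> \<le> \<theta>s"
  shows "0 \<le> rent q t \<theta> - rent q_cut t_cut \<theta>"
  using feasibleD(4)[OF f assms(1)] by (simp add: rent_cut rent_cut_below assms)

lemma payoff_gap:
  "payoff M q t - payoff M q_cut t_cut \<le>
    (LINT \<theta>|signal_law M. virtual_surplus q \<theta>) - (LINT \<theta>|signal_law M. virtual_surplus q_cut \<theta>)"
proof -
  note m = feasibleD(1-3)[OF f]
  note [measurable] = slope_meas[OF f] slope_meas[OF cut_feasible]
    measurable_rent[OF m(1)] measurable_rent[OF cutD(1)]
  note s = payoff_eq_surplus_minus_rent(1)[OF m] payoff_eq_surplus_minus_rent(1)[OF cutD(1-3)]
  note r = integrable_rent[OF m] integrable_rent[OF cutD(1-3)]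
  note w = integrable_virtual_surplus(1)[OF f] integrable_virtual_surplus(1)[OF cut_feasible]
  have "(LINT \<theta>|signal_law M. wedge \<theta> * (slope q \<theta> - slope q_cut \<theta>))
      \<le> (LINT \<theta>|signal_law M. rent q t \<theta> - rent q_cut t_cut \<theta>)"
  proof (rule expectation_ge_wedge)
    show "\<bar>slope q \<theta> - slope q_cut \<theta>\<bar> \<le> slope q (th_hi M) + slope q_cut (th_hi M)"
      if "\<theta> \<in> signals M" for \<theta>
      using slope_bound[OF f that] slope_bound[OF cut_feasible that] by linarith
  qed (use rent_gap rent_gap_nonneg in auto)
  then show ?thesis
    unfolding payoff_eq_surplus_minus_rent(2)[OF m] payoff_eq_surplus_minus_rent(2)[OF cutD(1-3)]
      virtual_surplus_def
    using s r w by (simp add: right_diff_distrib)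
qed

lemma payoff_le_cut: "payoff M q t \<le> payoff M q_cut t_cut"
proof -
  have "(LINT \<theta>|signal_law M. virtual_surplus q \<theta>) \<le> (LINT \<theta>|signal_law M. virtual_surplus q_cut \<theta>)"
    using integrable_virtual_surplus(2)[OF f] integrable_virtual_surplus(2)[OF cut_feasible]
  proof (rule integral_mono_AE)
    show "AE \<theta> in signal_law M. virtual_surplus q \<theta> \<le> virtual_surplus q_cut \<theta>"
      using AE_signal by eventually_elim (auto intro!: virtual_surplus_maximal(1)[OF f] simp: signals_def)
  qed
  then show ?thesis using payoff_gap by linarith
qed

section \<open>Mechanisms that attain the bound\<close>

context
  assumes best: "payoff M q_cut t_cut \<le> payoff M q t"
begin

lemma AE_allocation_eq:
  "AE \<theta> in signal_law M. AE z in shock_law M. q \<theta> (\<theta> * z) = q_cut \<theta> (\<theta> * z)"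
proof -
  note i = integrable_virtual_surplus(2)[OF f] integrable_virtual_surplus(2)[OF cut_feasible]
  have nn: "AE \<theta> in signal_law M. 0 \<le> virtual_surplus q_cut \<theta> - virtual_surplus q \<theta>"
    using AE_signal by eventually_elim
      (auto intro!: virtual_surplus_maximal(1)[OF f] simp: signals_def)
  then have "0 \<le> (LINT \<theta>|signal_law M. virtual_surplus q_cut \<theta> - virtual_surplus q \<theta>)"
    by (rule integral_nonneg_AE)
  then have "(LINT \<theta>|signal_law M. virtual_surplus q_cut \<theta> - virtual_surplus q \<theta>) = 0"
    using payoff_gap best i by simp
  then have "AE \<theta> in signal_law M. virtual_surplus q_cut \<theta> - virtual_surplus q \<theta> = 0"
    using integral_nonneg_eq_0_iff_AE[OF Bochner_Integration.integrable_diff[OF i(2,1)] nn] by simp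
  with AE_signal show ?thesis
  proof eventually_elim
    case (elim \<theta>)
    then show ?case using virtual_surplus_maximal(2)[OF f, of \<theta>] by (simp add: signals_def)
  qed
qed

text \<open>Equal allocations give equal slopes for almost every signal, so the rent gap is constant
  over all signals. Since surpluses agree, a payoff no smaller than the candidate's makes the mean
  gap at most 0, while participation at the lowest signal makes it at least 0.\<close>

lemma optimal_rent_eq:
  assumes "\<theta> \<in> signals M"
  shows "rent q t \<theta> = rent q_cut t_cut \<theta>"
proof -
  note m = feasibleD(1-3)[OF f]
  note [measurable] = slope_meas[OF f] slope_meas[OF cut_feasible]
    measurable_surplus[OF m(1)] measurable_surplus[OF cutD(1)]
    measurable_rent[OF m(1)] measurable_rent[OF cutD(1)]
  note [measurable (raw)] = measurable_q[OF m(1)] measurable_q[OF cutD(1)]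
  have eq: "AE \<theta> in signal_law M. slope q \<theta> = slope q_cut \<theta> \<and> surplus q \<theta> = surplus q_cut \<theta>"
    using AE_allocation_eq
  proof eventually_elim
    case (elim \<theta>)
    have "slope q \<theta> = slope q_cut \<theta>"
      unfolding slope_def
    proof (rule integral_cong_AE)
      show "AE z in shock_law M. z * q \<theta> (\<theta> * z) powr alpha M = z * q_cut \<theta> (\<theta> * z) powr alpha M"
        using elim by eventually_elim simp
    qed measurable
    moreover have "surplus q \<theta> = surplus q_cut \<theta>"
      unfolding surplus_def
    proof (rule integral_cong_AE)
      show "AE z in shock_law M. \<theta> * z * q \<theta> (\<theta> * z) powr alpha M - cost M * q \<theta> (\<theta> * z)
          = \<theta> * z * q_cut \<theta> (\<theta> * z) powr alpha M - cost M * q_cut \<theta> (\<theta> * z)"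
        using elim by eventually_elim simp
    qed measurable
    ultimately show ?case ..
  qed
  let ?D = "\<lambda>\<theta>. rent q t \<theta> - rent q_cut t_cut \<theta>"
  have const: "?D \<theta> = ?D (th_lo M)" if \<theta>: "\<theta> \<in> signals M" for \<theta>
  proof -
    have "(LINT x:{th_lo M..\<theta>}|lborel. slope q x - slope q_cut x) = (LINT x:{th_lo M..\<theta>}|lborel. 0)"
    proof (rule set_lebesgue_integral_cong_AE)
      show "AE x\<in>{th_lo M..\<theta>} in lborel. slope q x - slope q_cut x = 0"
        using AE_lborel_if_AE_signal[OF eq]
        by eventually_elim (use \<theta> in \<open>auto simp: signals_def\<close>)
    qed measurable
    then show ?thesis using rent_gap[OF \<theta>] by simp
  qed
  have "(LINT \<theta>|signal_law M. surplus q \<theta>) = (LINT \<theta>|signal_law M. surplus q_cut \<theta>)"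
    using eq by (intro integral_cong_AE) (auto elim!: eventually_mono)
  then have "(LINT \<theta>|signal_law M. ?D \<theta>) \<le> 0"
    using best integrable_rent[OF m] integrable_rent[OF cutD(1-3)]
    unfolding payoff_eq_surplus_minus_rent(2)[OF m] payoff_eq_surplus_minus_rent(2)[OF cutD(1-3)]
    by simp
  moreover have "(LINT \<theta>|signal_law M. ?D \<theta>) = (LINT \<theta>|signal_law M. ?D (th_lo M))"
  proof (rule integral_cong_AE)
    show "AE \<theta> in signal_law M. ?D \<theta> = ?D (th_lo M)"
      using AE_signal by eventually_elim (rule const, auto simp: signals_def)
  qed measurable
  moreover have "(LINT \<theta>|signal_law M. ?D (th_lo M)) = ?D (th_lo M)"
    using signal.prob_space by simp
  moreover have "0 \<le> ?D (th_lo M)"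
    using rent_gap_nonneg[OF th_lo_in] \<theta>s by (simp add: signals_def)
  ultimately show ?thesis using const[OF assms] by linarith
qed

end

end

text \<open>For almost every signal the allocations agree for almost every shock; monotonicity of
  one and continuity of the other extend this to every interior value. Both utilities then have the
  same subgradient in the value, so they differ by a constant, whose mean over the shock is the rent
  gap 0. This pins down the payments.\<close>

lemma optimum_eq_cut:
  assumes opt: "optimal M q t"
  shows "AE \<theta> in signal_law M. \<forall>v\<in>type_vals M \<theta>. q \<theta> v = q_cut \<theta> v \<and> t \<theta> v = t_cut \<theta> v"
proof -
  have f: "feasible M q t" and best: "payoff M q_cut t_cut \<le> payoff M q t"
    using opt cut_feasible by (auto simp: optimal_def)
  note m = feasibleD(1-3)[OF f]
  show ?thesis
    using AE_signal AE_allocation_eq[OF f best]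
  proof eventually_elim
    case (elim \<theta>)
    then have \<theta>: "\<theta> \<in> signals M" "0 < \<theta>" using signals by (auto simp: signals_def)
    have in_vals: "\<theta> * z \<in> vals M" if "z_lo M < z" "z < z_hi M" for z
      using that by (intro v_in_vals \<theta>) auto
    have qz: "q \<theta> (\<theta> * z) = q_cut \<theta> (\<theta> * z)" if "z \<in> {z_lo M<..<z_hi M}" for z
    proof (rule mono_AE_eq_continuous[where f = "\<lambda>z. q \<theta> (\<theta> * z)" and g = "\<lambda>z. q_cut \<theta> (\<theta> * z)", OF _ _ _ that])
      show "q \<theta> (\<theta> * x) \<le> q \<theta> (\<theta> * y)" if "z_lo M < x" "x \<le> y" "y < z_hi M" for x y
        using that \<theta> by (intro q_mono[OF m(1,2)] in_vals) auto
      show "continuous_on {z_lo M<..<z_hi M} (\<lambda>z. q_cut \<theta> (\<theta> * z))"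
        unfolding scaled_q_def using \<theta> shocks gam_pos
        by (intro continuous_intros continuous_on_powr') auto
      show "AE z in lborel. z \<in> {z_lo M<..<z_hi M} \<longrightarrow> q \<theta> (\<theta> * z) = q_cut \<theta> (\<theta> * z)"
        using elim(2) unfolding AE_shock_law_iff .
    qed
    have qv: "q \<theta> v = q_cut \<theta> v" if "v \<in> type_vals M \<theta>" for v
      using qz[of "v / \<theta>"] that \<theta> by (simp add: type_vals_iff)
    define w where "w v = utility M v (q \<theta> v) (t \<theta> v) - utility M v (q_cut \<theta> v) (t_cut \<theta> v)" for v
    have w_le: "w y = w x" if "x \<in> type_vals M \<theta>" "y \<in> type_vals M \<theta>" "x \<le> y" for x y
    proof (rule const_if_increment_le_product[OF that(3), where Q = "\<lambda>v. q \<theta> v powr alpha M"])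
      fix u v assume uv: "x \<le> u" "u \<le> v" "v \<le> y"
      then have tv: "u \<in> type_vals M \<theta>" "v \<in> type_vals M \<theta>" using that by (auto simp: type_vals_def)
      then have vals: "u \<in> vals M" "v \<in> vals M" using type_vals_subset[OF \<theta>(1)] by auto
      note s = utility_subgradient[OF m(1,2) \<theta>(1)] utility_subgradient[OF cutD(1,2) \<theta>(1)]
      show "\<bar>w v - w u\<bar> \<le> (v - u) * (q \<theta> v powr alpha M - q \<theta> u powr alpha M)"
        using s(1)[OF vals] s(1)[OF vals(2,1)] s(2)[OF vals] s(2)[OF vals(2,1)] qv[OF tv(1)] qv[OF tv(2)]
        unfolding w_def by (simp add: abs_le_iff algebra_simps)
    qed
    have w_const: "w y = w x" if "x \<in> type_vals M \<theta>" "y \<in> type_vals M \<theta>" for x y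
      using w_le[OF that] w_le[OF that(2,1)] by (cases "x \<le> y") auto
    define z0 where "z0 = (z_lo M + z_hi M) / 2"
    have z0: "\<theta> * z0 \<in> type_vals M \<theta>" using shocks \<theta> by (simp add: type_vals_iff z0_def)
    note i = integrable_utility[OF m(1,2) \<theta>(1) \<theta>(1)] integrable_utility[OF cutD(1,2) \<theta>(1) \<theta>(1)]
    have "0 = (LINT z|shock_law M. w (\<theta> * z))"
      unfolding w_def using i optimal_rent_eq[OF f best \<theta>(1)] by (simp add: gross_rent_def)
    also have "\<dots> = (LINT z|shock_law M. w (\<theta> * z0))"
    proof (rule integral_cong_AE)
      show "AE z in shock_law M. w (\<theta> * z) = w (\<theta> * z0)"
        using AE_shock by eventually_elim (use \<theta> z0 in \<open>auto intro!: w_const simp: type_vals_iff\<close>)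
      show "(\<lambda>z. w (\<theta> * z)) \<in> borel_measurable (shock_law M)"
        unfolding w_def using i by auto
    qed simp
    also have "\<dots> = w (\<theta> * z0)" using shock.prob_space by simp
    finally have "w v = 0" if "v \<in> type_vals M \<theta>" for v using w_const[OF z0 that] by simp
    then show ?case using qv by (auto simp: w_def utility_def)
  qed
qed

lemma cut_optimal: "optimal M q_cut t_cut"
  using cut_feasible payoff_le_cut by (auto simp: optimal_def)

definition star_scale :: "real \<Rightarrow> real" where
  "star_scale \<theta> = (alpha M / cost M * max 0 (virtual_type M \<theta> / \<theta>)) powr bet"

lemma star_scale_measurable [measurable]: "star_scale \<in> borel_measurable borel"
  using sig_dens_measurable unfolding star_scale_def virtual_type_def by measurable

text \<open>Interior values are positive, so the virtual value has the sign of the ratio and the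
  indicator becomes a positive part of a quantity that depends on the signal alone.\<close>

lemma q_star_eq:
  assumes "0 < \<theta>" "v \<in> type_vals M \<theta>"
  shows "q_star M \<theta> v = (alpha M / cost M * (v * max 0 (virtual_type M \<theta> / \<theta>))) powr gam"
proof -
  have v: "0 < v" by (rule type_vals_pos[OF assms])
  have e: "virtual_value M \<theta> v = v * (virtual_type M \<theta> / \<theta>)"
    using virtual_value_eq[OF assms] by simp
  have "0 \<le> virtual_value M \<theta> v \<longleftrightarrow> 0 \<le> virtual_type M \<theta> / \<theta>"
    unfolding e using v by (simp only: zero_le_mult_iff) auto
  then show ?thesis
    unfolding q_star_def by (cases "0 \<le> virtual_type M \<theta> / \<theta>") (simp_all add: e max_def)
qed

lemma q_star_powr:
  assumes "0 < \<theta>" "v \<in> type_vals M \<theta>"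
  shows "q_star M \<theta> v powr alpha M = star_scale \<theta> * v powr bet"
proof -
  have "q_star M \<theta> v powr alpha M =
      (alpha M / cost M * max 0 (virtual_type M \<theta> / \<theta>) * v) powr bet"
    unfolding q_star_eq[OF assms] by (simp add: powr_powr mult_ac)
  then show ?thesis by (simp only: star_scale_def powr_mult)
qed

lemma eff_ratio_above: "\<theta>s \<le> \<theta> \<Longrightarrow> eff_ratio \<theta> = virtual_type M \<theta> / \<theta>"
  using cutoff by (auto simp: eff_ratio_def)

lemma star_scale_above:
  assumes "\<theta> \<in> signals M" "\<theta>s \<le> \<theta>"
  shows "star_scale \<theta> = scale \<theta>"
  using eff_ratio_bounds(3)[OF assms(1)] eff_ratio_above[OF assms(2)]
  by (simp add: star_scale_def scale_def mult.commute)

text \<open>Where the density vanishes the ratio is 1 by the convention for division, still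
  different from the ratio of cost to spot price. This covers the lowest signal in the
  equivalence.\<close>

lemma virtual_ratio_ne_below:
  assumes "\<theta> \<in> signals M" "0 < \<theta>" "\<theta> < \<theta>s"
  shows "virtual_type M \<theta> / \<theta> \<noteq> cost M / spot_price M"
proof (cases "sig_dens M \<theta> = 0")
  case True
  then have "virtual_type M \<theta> / \<theta> = 1" using assms by (simp add: virtual_type_def)
  then show ?thesis using markup by auto
next
  case False
  then have "0 < sig_dens M \<theta>" using sig_dens_nonneg[of \<theta>] by simp
  then show ?thesis using virtual_ratio_below[OF assms] by simp
qed

lemma star_scale_below:
  assumes "\<theta> \<in> signals M" "th_lo M < \<theta>" "\<theta> < \<theta>s"
  shows "star_scale \<theta> \<le> scale \<theta>"
proof -
  have \<theta>: "0 < \<theta>" "0 < sig_dens M \<theta>"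
    using assms signals \<theta>s by (auto intro!: sig_dens_pos simp: signals_def)
  have "max 0 (virtual_type M \<theta> / \<theta>) \<le> eff_ratio \<theta>"
    using virtual_ratio_below[OF assms(1) \<theta>(1) assms(3) \<theta>(2)] eff_ratio_bounds[OF assms(1)] by simp
  then have "alpha M / cost M * max 0 (virtual_type M \<theta> / \<theta>) \<le> alpha M / cost M * eff_ratio \<theta>"
    using alpha cost_pos by (intro mult_left_mono) auto
  then show ?thesis
    unfolding star_scale_def scale_def using alpha cost_pos bet_pos
    by (intro powr_mono2) auto
qed

lemma q_cut_eq_q_star_iff:
  assumes "\<theta> \<in> signals M" "0 < \<theta>"
  shows "(\<forall>v\<in>type_vals M \<theta>. q_cut \<theta> v = q_star M \<theta> v) \<longleftrightarrow> \<theta>s \<le> \<theta>"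
proof
  assume eq: "\<forall>v\<in>type_vals M \<theta>. q_cut \<theta> v = q_star M \<theta> v"
  show "\<theta>s \<le> \<theta>"
  proof (rule ccontr)
    assume lt: "\<not> ?thesis"
    \<comment> \<open>A single interior value separates the two allocations, since both are strictly
      increasing in their ratio at a positive value.\<close>
    define v where "v = \<theta> * ((z_lo M + z_hi M) / 2)"
    have v: "v \<in> type_vals M \<theta>" using shocks assms(2) by (simp add: type_vals_iff v_def)
    have v0: "0 < v" by (rule type_vals_pos[OF assms(2) v])
    let ?r = "max 0 (virtual_type M \<theta> / \<theta>)"
    have "(alpha M * (eff_ratio \<theta> * v) / cost M) powr gam = (alpha M / cost M * (v * ?r)) powr gam"
      using eq v q_cut_eq[OF assms(1)] q_star_eq[OF assms(2) v] by simp
    moreover have "0 \<le> alpha M * (eff_ratio \<theta> * v) / cost M" "0 \<le> alpha M / cost M * (v * ?r)"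
      using alpha cost_pos v0 eff_ratio_bounds[OF assms(1)] by auto
    ultimately have "alpha M * (eff_ratio \<theta> * v) / cost M = alpha M / cost M * (v * ?r)"
      using gam_pos by (metis powr_less_mono2 not_less_iff_gr_or_eq)
    then have "eff_ratio \<theta> = ?r" using alpha cost_pos v0 by (simp add: field_simps)
    then have "virtual_type M \<theta> / \<theta> = cost M / spot_price M"
      using lt eff_ratio_bounds(3)[OF assms(1)] by (auto simp: eff_ratio_def max_def split: if_splits)
    then show False using virtual_ratio_ne_below[OF assms] lt by simp
  qed
next
  assume "\<theta>s \<le> \<theta>"
  then show "\<forall>v\<in>type_vals M \<theta>. q_cut \<theta> v = q_star M \<theta> v"
    using eff_ratio_above[of \<theta>] eff_ratio_bounds(3)[OF assms(1)]
    by (simp add: q_cut_eq[OF assms(1)] q_star_eq[OF assms(2)] mult_ac)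
qed

end

section \<open>Comparison with the optimum without a spot market\<close>

context screening_cutoff
begin

text \<open>
  Outside the support of the values of type \<open>\<theta>\<close> the quotient in \<open>virtual_value\<close> is \<open>0 / 0 = 0\<close>,
  which leaves the value itself.
\<close>

lemma q_star_outside:
  assumes "0 < \<theta>" "0 \<le> v" "v < \<theta> * z_lo M \<or> \<theta> * z_hi M < v"
  shows "q_star M \<theta> v powr alpha M = (alpha M / cost M * v) powr bet"
proof -
  have "virtual_value M \<theta> v = v"
    using val_dens_outside[OF assms(1,3)] by (simp add: virtual_value_def)
  then show ?thesis using assms(2) by (simp add: q_star_def powr_powr)
qed

text \<open>Inside the support the derivative in the signal is -(v / \<theta>) times the conditional
  density; beyond it the derivative is 0, so the arbitrary benchmark quantities there do not count.
  The substitution v = \<theta> z leaves the moment of the shock. The two boundary values, where the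
  derivative is not controlled, form a null set.\<close>

lemma star_inner_integral:
  assumes \<theta>: "\<theta> \<in> signals M" "0 < \<theta>"
  shows "(LINT v:vals M|lborel. q_star M \<theta> v powr alpha M * deriv (\<lambda>y. val_cdf M y v) \<theta>) =
    - (moment * star_scale \<theta> * \<theta> powr bet)"
proof -
  define g where "g v = star_scale \<theta> * v powr bet * (v / \<theta>) * (shock_dens M (v / \<theta>) / \<theta>)" for v
  have "(LINT v:vals M|lborel. q_star M \<theta> v powr alpha M * deriv (\<lambda>y. val_cdf M y v) \<theta>) =
      (LINT v|lborel. - g v)"
    unfolding set_lebesgue_integral_def
  proof (rule integral_discrete_difference[where X = "{\<theta> * z_lo M, \<theta> * z_hi M}"])
    fix v assume "v \<notin> {\<theta> * z_lo M, \<theta> * z_hi M}"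
    then consider "v \<in> type_vals M \<theta>" | "v < \<theta> * z_lo M \<or> \<theta> * z_hi M < v"
      by (force simp: type_vals_def)
    then show "indicat_real (vals M) v *\<^sub>R (q_star M \<theta> v powr alpha M * deriv (\<lambda>y. val_cdf M y v) \<theta>) = - g v"
    proof cases
      case 1
      then have "v \<in> vals M" using type_vals_subset[OF \<theta>(1)] by blast
      then show ?thesis
        using DERIV_imp_deriv[OF val_cdf_deriv[OF \<theta>(2) 1]] q_star_powr[OF \<theta>(2) 1]
        by (simp add: g_def val_dens_def)
    next
      case 2
      then show ?thesis
        using deriv_val_cdf_outside[OF \<theta>(2) 2] val_dens_outside[OF \<theta>(2) 2] \<theta>(2)
        by (simp add: g_def val_dens_def)
    qed
  qed auto
  also have "\<dots> = - (LINT v|lborel. g v)" by simp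
  also have "(LINT v|lborel. g v) = \<theta> * (LINT z|lborel. g (\<theta> * z))"
    using lborel_integral_real_affine[of \<theta> g 0] \<theta>(2) by simp
  also have "(LINT z|lborel. g (\<theta> * z)) =
      (LINT z|lborel. star_scale \<theta> * \<theta> powr bet / \<theta> * (z powr gam * shock_dens M z))"
  proof (intro Bochner_Integration.integral_cong refl)
    fix z
    show "g (\<theta> * z) = star_scale \<theta> * \<theta> powr bet / \<theta> * (z powr gam * shock_dens M z)"
    proof (cases "0 \<le> z")
      case True
      then show ?thesis using \<theta>(2) unfolding powr_gam[OF True] by (simp add: g_def powr_mult)
    next
      case False
      then have "shock_dens M z = 0" using shocks by (intro shock_dens_outside) auto
      then show ?thesis using \<theta>(2) by (simp add: g_def)
    qed
  qed
  also have "\<dots> = star_scale \<theta> * \<theta> powr bet / \<theta> * moment"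
    by (simp add: moment_def integral_shock_eq)
  finally show ?thesis using \<theta>(2) by simp
qed

lemma u_star_exp_eq:
  assumes "\<theta> \<in> signals M"
  shows "u_star_exp M \<theta> = moment * (LINT x:{th_lo M..\<theta>}|lborel. star_scale x * x powr bet)"
proof -
  have "(LINT x:{th_lo M..\<theta>}|lborel.
        (LINT v:vals M|lborel. q_star M x v powr alpha M * deriv (\<lambda>y. val_cdf M y v) x)) =
      (LINT x:{th_lo M..\<theta>}|lborel. - (moment * star_scale x * x powr bet))"
    unfolding set_lebesgue_integral_def[of _ "{th_lo M..\<theta>}"]
  proof (rule integral_discrete_difference[where X = "{0}"])
    fix x :: real assume x: "x \<notin> {0}"
    show "indicat_real {th_lo M..\<theta>} x *\<^sub>R
          (LINT v:vals M|lborel. q_star M x v powr alpha M * deriv (\<lambda>y. val_cdf M y v) x) =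
        indicat_real {th_lo M..\<theta>} x *\<^sub>R (- (moment * star_scale x * x powr bet))"
    proof (cases "x \<in> {th_lo M..\<theta>}")
      case True
      then have "x \<in> signals M" "0 < x" using x assms signals by (auto simp: signals_def)
      then show ?thesis using star_inner_integral by simp
    qed simp
  qed auto
  also have "\<dots> = - (moment * (LINT x:{th_lo M..\<theta>}|lborel. star_scale x * x powr bet))"
    unfolding set_lebesgue_integral_def by (simp add: mult_ac)
  finally show ?thesis by (simp add: u_star_exp_def)
qed

lemma star_slope_integrable:
  assumes "x \<in> signals M" "y \<in> signals M"
  shows "set_integrable lborel {x..y} (\<lambda>u. star_scale u * u powr bet)"
proof (rule set_integrable_bounded_on)
  show "\<bar>star_scale u * u powr bet\<bar> \<le> (alpha M / cost M) powr bet * th_hi M powr bet"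
    if "u \<in> {th_lo M..th_hi M}" for u
  proof (cases "u = 0")
    case False
    then have u: "0 < u" using that signals by auto
    have "alpha M / cost M * max 0 (virtual_type M u / u) \<le> alpha M / cost M * 1"
      using virtual_ratio_le_1[OF u] alpha cost_pos by (intro mult_left_mono) auto
    then have "star_scale u \<le> (alpha M / cost M) powr bet"
      unfolding star_scale_def using alpha cost_pos bet_pos by (intro powr_mono2) auto
    moreover have "0 \<le> star_scale u" by (simp add: star_scale_def)
    moreover have "u powr bet \<le> th_hi M powr bet"
      using u that bet_pos by (intro powr_mono2) auto
    ultimately show ?thesis by (simp add: abs_mult mult_mono)
  qed simp
qed (use assms in \<open>auto simp: signals_def\<close>)

definition compensation :: real where
  "compensation = spot_utility M \<theta>s - u_star_exp M \<theta>s"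

text \<open>Up to the cutoff the benchmark rent grows no faster than the candidate's and starts from
  0 instead of the lowest signal's spot utility, which is nonnegative. At the cutoff the candidate's
  rent is the spot utility.\<close>

lemma compensation_nonneg: "0 \<le> compensation"
proof -
  have lo: "th_lo M \<le> \<theta>s" using \<theta>s by (simp add: signals_def)
  have "(LINT x:{th_lo M..\<theta>s}|lborel. star_scale x * x powr bet)
      \<le> (LINT x:{th_lo M..\<theta>s}|lborel. scale x * x powr bet)"
    using star_slope_integrable[OF th_lo_in \<theta>s] scaled_slope_integrable[OF scale th_lo_in \<theta>s]
  proof (rule set_integral_mono_AE)
    show "AE x\<in>{th_lo M..\<theta>s} in lborel. star_scale x * x powr bet \<le> scale x * x powr bet"
      using AE_lborel_singleton[of "th_lo M"] AE_lborel_singleton[of \<theta>s]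
    proof eventually_elim
      case (elim x)
      show ?case
      proof
        assume "x \<in> {th_lo M..\<theta>s}"
        then have "star_scale x \<le> scale x"
          using elim \<theta>s by (intro star_scale_below) (auto simp: signals_def)
        then show "star_scale x * x powr bet \<le> scale x * x powr bet" by (simp add: mult_right_mono)
      qed
    qed
  qed
  then have "u_star_exp M \<theta>s \<le> moment * (LINT x:{th_lo M..\<theta>s}|lborel. scale x * x powr bet)"
    unfolding u_star_exp_eq[OF \<theta>s] using moment_pos by simp
  also have "\<dots> \<le> scaled_rent scale \<theta>s"
    using moment_pos spot_scale_pos gam_pos by (simp add: scaled_rent_def)
  also have "\<dots> = spot_utility M \<theta>s" by (rule rent_cut_below[OF \<theta>s order_refl])
  finally show ?thesis by (simp add: compensation_def)
qed

text \<open>Above the cutoff both rents have the same slope, so their difference stays at its cutoff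
  value; this is why the rebate is constant.\<close>

lemma scaled_rent_eq_u_star:
  assumes \<theta>: "\<theta> \<in> signals M" "\<theta>s \<le> \<theta>"
  shows "scaled_rent scale \<theta> = u_star_exp M \<theta> + compensation"
proof -
  have lo: "th_lo M \<le> \<theta>s" using \<theta>s by (simp add: signals_def)
  have "(LINT x:{\<theta>s..\<theta>}|lborel. star_scale x * x powr bet) = (LINT x:{\<theta>s..\<theta>}|lborel. scale x * x powr bet)"
    using \<theta> \<theta>s star_scale_above by (intro set_lebesgue_integral_cong) (auto simp: signals_def)
  then have "u_star_exp M \<theta> = u_star_exp M \<theta>s + moment * (LINT x:{\<theta>s..\<theta>}|lborel. scale x * x powr bet)"
    unfolding u_star_exp_eq[OF \<theta>s] u_star_exp_eq[OF \<theta>(1)]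
    using set_integral_Icc_combine[OF star_slope_integrable[OF th_lo_in \<theta>(1)] lo \<theta>(2)]
    by (simp add: algebra_simps)
  then show ?thesis
    using scaled_rent_diff[OF scale \<theta>s \<theta>] rent_cut_below[OF \<theta>s order_refl]
    by (simp add: compensation_def)
qed

text \<open>The integral in \<open>u_star\<close> starts at the lowest value of any type and may
  cross values impossible for \<theta>, where \<open>q_star\<close> is arbitrary. That stretch adds
  the same amount for every value in the support, and the normalization of the mean in
  \<open>u_star_lo\<close> removes it.\<close>

lemma u_star_eq:
  assumes \<theta>: "\<theta> \<in> signals M" "\<theta>s \<le> \<theta>" and v: "v \<in> type_vals M \<theta>"
  shows "u_star M \<theta> v = u_star_exp M \<theta> + scale \<theta> / gam * (v powr gam - moment * \<theta> powr gam)"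
proof -
  have \<theta>0: "0 < \<theta>" using cutoff_props(1) \<theta>(2) by linarith
  have v_lo: "0 \<le> v_lo M" by (rule vals_nonneg[OF v_lo_in_vals])
  have \<theta>z: "v_lo M \<le> \<theta> * z_lo M"
    using \<theta>(1) shocks unfolding v_lo_def by (intro mult_right_mono) (auto simp: signals_def)
  \<comment> \<open>An explicit measurable form of the integrand; it may differ from it at the two
    ends of the support only.\<close>
  define h where "h x = (if x < \<theta> * z_lo M \<or> \<theta> * z_hi M < x then (alpha M / cost M * x) powr bet
    else scale \<theta> * x powr bet)" for x
  have h_meas [measurable]: "h \<in> borel_measurable borel"
    unfolding h_def by measurable
  define J where "J v = (LINT x:{v_lo M..v}|lborel. h x)" for v
  have J_eq: "(LINT x:{v_lo M..v}|lborel. q_star M \<theta> x powr alpha M) = J v" for v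
    unfolding J_def set_lebesgue_integral_def
  proof (rule integral_discrete_difference[where X = "{\<theta> * z_lo M, \<theta> * z_hi M}"])
    fix x assume x: "x \<notin> {\<theta> * z_lo M, \<theta> * z_hi M}"
    show "indicat_real {v_lo M..v} x *\<^sub>R q_star M \<theta> x powr alpha M = indicat_real {v_lo M..v} x *\<^sub>R h x"
    proof (cases "x \<in> {v_lo M..v}")
      case True
      then have "0 \<le> x" using v_lo by simp
      then have "q_star M \<theta> x powr alpha M = h x"
      proof (cases "x \<in> type_vals M \<theta>")
        case True
        then show ?thesis
          using q_star_powr[OF \<theta>0 True] star_scale_above[OF \<theta>] by (simp add: h_def type_vals_def)
      next
        case False
        then have "x < \<theta> * z_lo M \<or> \<theta> * z_hi M < x" using x by (force simp: type_vals_def)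
        then show ?thesis using q_star_outside[OF \<theta>0 \<open>0 \<le> x\<close>] by (simp add: h_def)
      qed
      then show ?thesis by simp
    qed simp
  qed auto
  have J_meas: "J \<in> borel_measurable borel"
    unfolding J_def set_lebesgue_integral_def
    by (rule lborel.borel_measurable_lebesgue_integral) (simp add: indicator_def case_prod_beta, measurable)
  \<comment> \<open>Collects all that does not depend on v; it cancels when the mean is
    subtracted.\<close>
  define C where "C = J (\<theta> * z_lo M) - scale \<theta> * (\<theta> * z_lo M) powr gam / gam"
  have J_type: "J v = C + scale \<theta> / gam * v powr gam" if v: "v \<in> type_vals M \<theta>" for v
  proof -
    have zv: "\<theta> * z_lo M \<le> v" "v \<le> \<theta> * z_hi M" using v by (auto simp: type_vals_def)
    have "set_integrable lborel {v_lo M..v} h"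
    proof (rule set_integrable_bounded_on[OF h_meas])
      show "\<bar>h x\<bar> \<le> max ((alpha M / cost M * v) powr bet) (scale \<theta> * v powr bet)"
        if "x \<in> {v_lo M..v}" for x
      proof -
        have x: "0 \<le> x" "x \<le> v" using that v_lo by auto
        have "(alpha M / cost M * x) powr bet \<le> (alpha M / cost M * v) powr bet"
          using x alpha cost_pos bet_pos by (intro powr_mono2 mult_left_mono) auto
        moreover have "scale \<theta> * x powr bet \<le> scale \<theta> * v powr bet"
          using x bet_pos by (intro mult_left_mono powr_mono2) (auto simp: scale_def)
        moreover have "0 \<le> scale \<theta> * x powr bet" by (simp add: scale_def)
        ultimately show ?thesis by (auto simp: h_def)
      qed
    qed auto
    then have "J v = J (\<theta> * z_lo M) + (LINT x:{\<theta> * z_lo M..v}|lborel. h x)"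
      unfolding J_def by (rule set_integral_Icc_combine[OF _ \<theta>z zv(1)])
    also have "(LINT x:{\<theta> * z_lo M..v}|lborel. h x) = (LINT x:{\<theta> * z_lo M..v}|lborel. scale \<theta> * x powr bet)"
      using zv by (intro set_lebesgue_integral_cong) (auto simp: h_def)
    also have "\<dots> = scale \<theta> * (v powr gam - (\<theta> * z_lo M) powr gam) / gam"
      using powr_integral[OF less_imp_le[OF bet_pos] _ zv(1)] \<theta>0 shocks
      unfolding gam_eq[symmetric] by simp
    finally show ?thesis
      by (simp only: C_def right_diff_distrib diff_divide_distrib) simp
  qed
  have "(LINT v|value_law M \<theta>. J v) = (LINT z|shock_law M. J (\<theta> * z))"
    by (rule integral_value_law[OF J_meas])
  also have "\<dots> = (LINT z|shock_law M. C + scale \<theta> / gam * (\<theta> * z) powr gam)"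
  proof (rule integral_shock_cong)
    show "(\<lambda>z. J (\<theta> * z)) \<in> borel_measurable borel"
      by (rule measurable_compose[OF _ J_meas]) measurable
    show "J (\<theta> * z) = C + scale \<theta> / gam * (\<theta> * z) powr gam" if "z \<in> {z_lo M<..<z_hi M}" for z
      by (rule J_type) (use that \<theta>0 in \<open>simp add: type_vals_iff\<close>)
  qed measurable
  also have "\<dots> = C + scale \<theta> / gam * (moment * \<theta> powr gam)"
  proof -
    have "integrable (shock_law M) (\<lambda>z. scale \<theta> / gam * (\<theta> * z) powr gam)"
      using integrable_shock_powr by (simp add: powr_mult)
    moreover have "shock.prob UNIV = 1" using shock.prob_space by simp
    ultimately show ?thesis
      unfolding integral_shock_powr[OF less_imp_le[OF \<theta>0], symmetric]
      by (subst Bochner_Integration.integral_add) simp_all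
  qed
  finally show ?thesis
    unfolding u_star_def u_star_lo_def J_eq J_type[OF v] by (simp only: right_diff_distrib)
qed

lemma t_cut_eq_t_star:
  assumes "\<theta> \<in> signals M" "\<theta>s \<le> \<theta>" "v \<in> type_vals M \<theta>"
  shows "t_cut \<theta> v = t_star M \<theta> v - compensation"
proof -
  have \<theta>0: "0 < \<theta>" using cutoff_props(1) assms(2) by linarith
  have "q_cut \<theta> v = q_star M \<theta> v"
    using q_cut_eq_q_star_iff[OF assms(1) \<theta>0] assms(2,3) by blast
  then show ?thesis
    unfolding scaled_t_def t_star_def u_star_eq[OF assms] scaled_rent_eq_u_star[OF assms(1,2)] by simp
qed

end

text \<open>An optimum is fixed only up to null sets of signals, so the equivalence holds almost
  surely for every optimum and at each positive signal for a suitable one, which also shows that the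
  first clause is not vacuous at positive cost. At the signal 0 the set \<open>type_vals\<close> is
  empty and equality of the allocations would be trivial.\<close>

theorem proposition3:
  fixes M :: screening and \<theta>s :: real
  assumes "screening_model M"
    and "\<theta>s \<in> signals M"
    and "virtual_type M \<theta>s / \<theta>s = cost M / spot_price M"
  defines "t_c \<equiv> spot_utility M \<theta>s - u_star_exp M \<theta>s"
  shows "(\<forall>q\<^sub>D t\<^sub>D. optimal M q\<^sub>D t\<^sub>D \<longrightarrow>
           (AE \<theta> in signal_law M.
             ((\<forall>v\<in>type_vals M \<theta>. q\<^sub>D \<theta> v = q_star M \<theta> v) \<longleftrightarrow> \<theta>s \<le> \<theta>) \<and>
             (\<theta>s \<le> \<theta> \<longrightarrow> (\<forall>v\<in>type_vals M \<theta>. t\<^sub>D \<theta> v = t_star M \<theta> v - t_c))))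
       \<and> (0 < cost M \<longrightarrow>
           (\<exists>q\<^sub>D t\<^sub>D. optimal M q\<^sub>D t\<^sub>D \<and>
             (\<forall>\<theta>\<in>signals M. 0 < \<theta> \<longrightarrow>
               ((\<forall>v\<in>type_vals M \<theta>. q\<^sub>D \<theta> v = q_star M \<theta> v) \<longleftrightarrow> \<theta>s \<le> \<theta>) \<and>
               (\<theta>s \<le> \<theta> \<longrightarrow> (\<forall>v\<in>type_vals M \<theta>. t\<^sub>D \<theta> v = t_star M \<theta> v - t_c)))))
       \<and> 0 \<le> t_c"
proof -
  interpret screening_model M by fact
  show ?thesis
  \<comment> \<open>With zero cost no optimum exists, so only the sign of \<open>t_c\<close> is left
    to show.\<close>
  proof (cases "cost M = 0")
    case True
    then show ?thesis
      using no_optimum_if_costless compensation_nonneg_if_costless assms(2) by (auto simp: t_c_def)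
  next
    case False
    then have pos: "0 < cost M" using cost by simp
    interpret screening_cutoff M \<theta>s
      by unfold_locales (use assms pos in auto)
    have tc: "t_c = compensation" by (simp add: t_c_def compensation_def)
    have cut: "((\<forall>v\<in>type_vals M \<theta>. q_cut \<theta> v = q_star M \<theta> v) \<longleftrightarrow> \<theta>s \<le> \<theta>) \<and>
        (\<theta>s \<le> \<theta> \<longrightarrow> (\<forall>v\<in>type_vals M \<theta>. t_cut \<theta> v = t_star M \<theta> v - t_c))"
      if "\<theta> \<in> signals M" "0 < \<theta>" for \<theta>
      using q_cut_eq_q_star_iff[OF that] t_cut_eq_t_star[OF that(1)] tc by blast
    have unique: "AE \<theta> in signal_law M.
        ((\<forall>v\<in>type_vals M \<theta>. q \<theta> v = q_star M \<theta> v) \<longleftrightarrow> \<theta>s \<le> \<theta>) \<and>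
        (\<theta>s \<le> \<theta> \<longrightarrow> (\<forall>v\<in>type_vals M \<theta>. t \<theta> v = t_star M \<theta> v - t_c))"
      if "optimal M q t" for q t
      using AE_signal optimum_eq_cut[OF that]
    proof eventually_elim
      case (elim \<theta>)
      then have "\<theta> \<in> signals M" "0 < \<theta>" using signals by (auto simp: signals_def)
      from cut[OF this] elim(2) show ?case by simp
    qed
    show ?thesis
      using unique cut cut_optimal compensation_nonneg tc by blast
  qed
qed

end
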